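(* There exists a universal constant $C>0$ such that the following holds for all integers $n\ge 2$ and $k\ge 1$. Let $A$ be a real symmetric $n\times n$ matrix with zero diagonal entries, and let $\pi$ be a centered probability measure supported on real $k\times k$ matrices with spectral norm at most $1$. Let $A^{(k,\pi)}$ be the $(k,\pi)$ lift of $A$ (a random symmetric $kn\times kn$ matrix). Then for every $\epsilon\in(0,1/2]$, $$\mathbb{E}\,\|A^{(k,\pi)}\| \le 2(1+\epsilon)\,\sigma + \frac{C}{\sqrt{\log(1+\epsilon)}}\,\sigma_*\sqrt{\log(kn)},$$ where $$\sigma := \max_{1\le i\le n}\sqrt{\sum_{j=1}^n A_{ij}^2},\qquad \sigma_* := \max_{1\le i,j\le n}|A_{ij}|.$$
   Context: All matrices are real, $\|\cdot\|$ is the spectral (operator) norm, and $\log$ is the natural logarithm. A probability measure $\pi$ on $k\times k$ matrices is centered if $\mathbb{E}[\Pi]=0$ for $\Pi\sim\pi$. Matrix lift: let $A$ be an $n\times n$ symmetric matrix with zero diagonal entries and $\pi$ a probability measure supported on $k\times k$ matrices (not necessarily symmetric). The $(k,\pi)$ lift $A^{(k,\pi)}$ is defined as follows. Draw i.i.d. samples $\{\Pi_{ij}\}_{1\le i<j\le n}$ from $\pi$; for $1\le i<j\le n$ put $\Pi_{ji}:=\Pi_{ij}^\top$; for $1\le i\le n$ put $\Pi_{ii}:=0$ (the $k\times k$ zero matrix). Then $$A^{(k,\pi)} = \sum_{1\le i,j\le n}A_{ij}\,(E_{ij}\otimes \Pi_{ij}),$$ where $E_{ij}=e_ie_j^\top$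 is the $n\times n$ matrix unit and $\otimes$ is the Kronecker product; i.e. $A^{(k,\pi)}$ is the $kn\times kn$ symmetric random block matrix whose $(i,j)$ block of size $k\times k$ is $A_{ij}\Pi_{ij}$. *)

theory Defs
  imports "HOL-Probability.Probability" "Jordan_Normal_Form.Matrix"
begin

definition vec_l2 :: "real Matrix.vec \<Rightarrow> real" where
  "vec_l2 v = L2_set (vec_index v) {..<dim_vec v}"

definition spectral_norm :: "real Matrix.mat \<Rightarrow> real" where
  "spectral_norm M = (SUP x \<in> {x \<in> carrier_vec (dim_col M). vec_l2 x \<le> 1}. vec_l2 (M *\<^sub>v x))"

definition kronecker :: "real Matrix.mat \<Rightarrow> real Matrix.mat \<Rightarrow> real Matrix.mat" where
  "kronecker A B = Matrix.mat (dim_row A * dim_row B) (dim_col A * dim_col B)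
     (\<lambda>(r, s). A $$ (r div dim_row B, s div dim_col B) * B $$ (r mod dim_row B, s mod dim_col B))"

definition matrix_unit :: "nat \<Rightarrow> nat \<Rightarrow> nat \<Rightarrow> real Matrix.mat" where
  "matrix_unit n i j = Matrix.mat n n (\<lambda>(a, b). if a = i \<and> b = j then 1 else 0)"

text \<open>The Borel sigma-algebra on \<open>k \<times> k\<close> matrices, as the one generated by the \<open>k\<^sup>2\<close> entries.\<close>

definition mat_borel :: "nat \<Rightarrow> real Matrix.mat measure" where
  "mat_borel k = vimage_algebra (carrier_mat k k)
     (\<lambda>M. restrict (($$) M) ({..<k} \<times> {..<k})) (PiM ({..<k} \<times> {..<k}) (\<lambda>_. borel))"

definition centered :: "nat \<Rightarrow> real Matrix.mat measure \<Rightarrow> bool" where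
  "centered k \<pi> \<longleftrightarrow>
     (\<forall>a<k. \<forall>b<k. integrable \<pi> (\<lambda>M. M $$ (a, b)) \<and> (\<integral>M. M $$ (a, b) \<partial>\<pi>) = 0)"

definition upper_pairs :: "nat \<Rightarrow> (nat \<times> nat) set" where
  "upper_pairs n = {(i, j). i < j \<and> j < n}"

text \<open>The independent samples, indexed by the pairs above the diagonal, are the coordinates of a
  product space. Indices start at 0.\<close>

definition sample_space :: "nat \<Rightarrow> real Matrix.mat measure \<Rightarrow> (nat \<times> nat \<Rightarrow> real Matrix.mat) measure" where
  "sample_space n \<pi> = PiM (upper_pairs n) (\<lambda>_. \<pi>)"

definition sym_sample :: "nat \<Rightarrow> (nat \<times> nat \<Rightarrow> real Matrix.mat) \<Rightarrow> nat \<Rightarrow> nat \<Rightarrow> real Matrix.mat" where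
  "sym_sample k \<omega> i j =
     (if i < j then \<omega> (i, j) else if j < i then transpose_mat (\<omega> (j, i)) else 0\<^sub>m k k)"

definition matrix_lift ::
  "nat \<Rightarrow> nat \<Rightarrow> real Matrix.mat \<Rightarrow> (nat \<times> nat \<Rightarrow> real Matrix.mat) \<Rightarrow> real Matrix.mat" where
  "matrix_lift n k A \<omega> =
     finsum (module_mat TYPE(real) (n * k) (n * k))
       (\<lambda>(i, j). A $$ (i, j) \<cdot>\<^sub>m kronecker (matrix_unit n i j) (sym_sample k \<omega> i j))
       ({..<n} \<times> {..<n})"

definition row_sigma :: "nat \<Rightarrow> real Matrix.mat \<Rightarrow> real" where
  "row_sigma n A = Max ((\<lambda>i. sqrt (\<Sum>j<n. (A $$ (i, j))\<^sup>2)) ` {..<n})"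

definition max_entry :: "nat \<Rightarrow> real Matrix.mat \<Rightarrow> real" where
  "max_entry n A = Max ((\<lambda>(i, j). \<bar>A $$ (i, j)\<bar>) ` ({..<n} \<times> {..<n}))"

lemma finsum_mat_index:
  assumes "finite S" "\<And>p. p \<in> S \<Longrightarrow> f p \<in> carrier_mat N N'" "r < N" "s < N'"
  shows "finsum (module_mat TYPE(real) N N') f S \<in> carrier_mat N N' \<and>
    finsum (module_mat TYPE(real) N N') f S $$ (r, s) = (\<Sum>p\<in>S. f p $$ (r, s))"
proof -
  interpret abelian_group "module_mat TYPE(real) N N'"
    by (rule abelian_group_mat)
  show ?thesis using assms(1,2)
  proof (induction S rule: finite_induct)
    case empty
    then show ?case using assms(3,4) by (simp add: module_mat_simps)
  next
    case (insert x F)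
    have "finsum (module_mat TYPE(real) N N') f (insert x F) =
        f x + finsum (module_mat TYPE(real) N N') f F"
      by (subst finsum_insert) (use insert in \<open>auto simp: module_mat_simps\<close>)
    then show ?case using insert assms(3,4) by auto
  qed
qed

lemma matrix_lift_carrier:
  assumes "\<And>i j. (i, j) \<in> upper_pairs n \<Longrightarrow> \<omega> (i, j) \<in> carrier_mat k k"
  shows "matrix_lift n k A \<omega> \<in> carrier_mat (n * k) (n * k)"
proof -
  interpret abelian_group "module_mat TYPE(real) (n * k) (n * k)"
    by (rule abelian_group_mat)
  have "sym_sample k \<omega> i j \<in> carrier_mat k k" if "i < n" "j < n" for i j
    using assms that by (auto simp: sym_sample_def upper_pairs_def)
  then show ?thesis
    using finsum_closed[of "\<lambda>(i, j). A $$ (i, j) \<cdot>\<^sub>m kronecker (matrix_unit n i j) (sym_sample k \<omega> i j)"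
        "{..<n} \<times> {..<n}"]
    by (fastforce simp: matrix_lift_def module_mat_simps kronecker_def matrix_unit_def)
qed

lemma matrix_lift_index:
  assumes "\<And>i j. (i, j) \<in> upper_pairs n \<Longrightarrow> \<omega> (i, j) \<in> carrier_mat k k"
    and r: "r < n * k" and s: "s < n * k"
  shows "matrix_lift n k A \<omega> $$ (r, s) =
    A $$ (r div k, s div k) * sym_sample k \<omega> (r div k) (s div k) $$ (r mod k, s mod k)"
proof -
  have c: "sym_sample k \<omega> i j \<in> carrier_mat k k" if "i < n" "j < n" for i j
    using assms(1) that by (auto simp: sym_sample_def upper_pairs_def)
  have d: "r div k < n" "s div k < n"
    using r s by (auto simp: less_mult_imp_div_less)
  let ?f = "\<lambda>(i, j). A $$ (i, j) \<cdot>\<^sub>m kronecker (matrix_unit n i j) (sym_sample k \<omega> i j)"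
  have "matrix_lift n k A \<omega> $$ (r, s) = (\<Sum>p\<in>{..<n} \<times> {..<n}. ?f p $$ (r, s))"
    unfolding matrix_lift_def
    by (rule finsum_mat_index[THEN conjunct2])
       (use r s c in \<open>fastforce simp: kronecker_def matrix_unit_def\<close>)+
  also have "\<dots> = (\<Sum>p\<in>{..<n} \<times> {..<n}. if p = (r div k, s div k) then
      A $$ (r div k, s div k) * sym_sample k \<omega> (r div k) (s div k) $$ (r mod k, s mod k) else 0)"
  proof (rule sum.cong[OF refl])
    fix p assume "p \<in> {..<n} \<times> {..<n}"
    then obtain i j where p: "p = (i, j)" "i < n" "j < n" by auto
    have "dim_row (sym_sample k \<omega> i j) = k" "dim_col (sym_sample k \<omega> i j) = k"
      using c[OF p(2,3)] by auto
    then show "?f p $$ (r, s) = (if p = (r div k, s div k) then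
      A $$ (r div k, s div k) * sym_sample k \<omega> (r div k) (s div k) $$ (r mod k, s mod k) else 0)"
      using r s d by (auto simp: p kronecker_def matrix_unit_def)
  qed
  also have "\<dots> = A $$ (r div k, s div k) * sym_sample k \<omega> (r div k) (s div k) $$ (r mod k, s mod k)"
    using d by (simp add: sum.delta)
  finally show ?thesis .
qed

lemma vec_l2_mult_le:
  assumes M: "M \<in> carrier_mat m l" and x: "x \<in> carrier_vec l" and "vec_l2 x \<le> 1"
  shows "vec_l2 (M *\<^sub>v x) \<le> (\<Sum>p\<in>{..<m} \<times> {..<l}. \<bar>M $$ p\<bar>)"
proof -
  have xi: "\<bar>vec_index x b\<bar> \<le> 1" if "b < l" for b
  proof -
    have "\<bar>vec_index x b\<bar> \<le> L2_set (\<lambda>i. \<bar>vec_index x i\<bar>) {..<l}"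
      by (rule member_le_L2_set) (use that in auto)
    also have "L2_set (\<lambda>i. \<bar>vec_index x i\<bar>) {..<l} = vec_l2 x"
      using x by (simp add: vec_l2_def L2_set_def)
    finally show ?thesis using assms(3) by linarith
  qed
  have "vec_l2 (M *\<^sub>v x) \<le> (\<Sum>a<m. \<bar>vec_index (M *\<^sub>v x) a\<bar>)"
    using L2_set_le_sum_abs[of "vec_index (M *\<^sub>v x)" "{..<m}"] M by (simp add: vec_l2_def)
  also have "\<dots> \<le> (\<Sum>a<m. \<Sum>b<l. \<bar>M $$ (a, b)\<bar>)"
  proof (rule sum_mono)
    fix a assume a: "a \<in> {..<m}"
    have "\<bar>vec_index (M *\<^sub>v x) a\<bar> = \<bar>\<Sum>b<l. M $$ (a, b) * vec_index x b\<bar>"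
      using a M x by (auto simp: scalar_prod_def atLeast0LessThan)
    also have "\<dots> \<le> (\<Sum>b<l. \<bar>M $$ (a, b) * vec_index x b\<bar>)" by (rule sum_abs)
    also have "\<dots> \<le> (\<Sum>b<l. \<bar>M $$ (a, b)\<bar>)"
      by (rule sum_mono) (auto simp: abs_mult intro!: mult_left_le xi)
    finally show "\<bar>vec_index (M *\<^sub>v x) a\<bar> \<le> (\<Sum>b<l. \<bar>M $$ (a, b)\<bar>)" .
  qed
  also have "\<dots> = (\<Sum>p\<in>{..<m} \<times> {..<l}. \<bar>M $$ p\<bar>)"
    by (simp add: sum.cartesian_product case_prod_eta)
  finally show ?thesis .
qed

lemma spectral_norm_upper:
  assumes "M \<in> carrier_mat m l" "x \<in> carrier_vec l" "vec_l2 x \<le> 1"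
  shows "vec_l2 (M *\<^sub>v x) \<le> spectral_norm M"
  unfolding spectral_norm_def
proof (rule cSUP_upper)
  show "x \<in> {x \<in> carrier_vec (dim_col M). vec_l2 x \<le> 1}" using assms by auto
  show "bdd_above ((\<lambda>x. vec_l2 (M *\<^sub>v x)) ` {x \<in> carrier_vec (dim_col M). vec_l2 x \<le> 1})"
    using vec_l2_mult_le[OF assms(1)] assms(1) by (intro bdd_aboveI2) auto
qed

lemma spectral_norm_least:
  assumes "M \<in> carrier_mat m l"
    and "\<And>x. x \<in> carrier_vec l \<Longrightarrow> vec_l2 x \<le> 1 \<Longrightarrow> vec_l2 (M *\<^sub>v x) \<le> c"
  shows "spectral_norm M \<le> c"
  unfolding spectral_norm_def
proof (rule cSUP_least)
  have "0\<^sub>v l \<in> {x \<in> carrier_vec (dim_col M). vec_l2 x \<le> 1}"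
    using assms(1) by (auto simp: vec_l2_def L2_set_def)
  then show "{x \<in> carrier_vec (dim_col M). vec_l2 x \<le> 1} \<noteq> {}" by blast
qed (use assms in auto)

lemma spectral_norm_lipschitz:
  assumes M: "M \<in> carrier_mat m l" and N: "N \<in> carrier_mat m l"
  shows "spectral_norm M \<le> spectral_norm N + (\<Sum>p\<in>{..<m} \<times> {..<l}. \<bar>M $$ p - N $$ p\<bar>)"
proof (rule spectral_norm_least[OF M])
  fix x assume x: "x \<in> carrier_vec l" "vec_l2 x \<le> 1"
  have D: "M - N \<in> carrier_mat m l" using N by auto
  have "vec_l2 (M *\<^sub>v x) = L2_set (\<lambda>a. vec_index (N *\<^sub>v x) a + vec_index ((M - N) *\<^sub>v x) a) {..<m}"
    unfolding vec_l2_def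
  proof (rule L2_set_cong)
    show "{..<dim_vec (M *\<^sub>v x)} = {..<m}" using M by simp
    fix a assume "a \<in> {..<m}"
    then have a: "a < m" by simp
    have "(\<Sum>b<l. M $$ (a, b) * vec_index x b) =
        (\<Sum>b<l. N $$ (a, b) * vec_index x b) + (\<Sum>b<l. (M $$ (a, b) - N $$ (a, b)) * vec_index x b)"
      unfolding sum.distrib[symmetric] by (rule sum.cong) (simp_all add: left_diff_distrib)
    then show "vec_index (M *\<^sub>v x) a = vec_index (N *\<^sub>v x) a + vec_index ((M - N) *\<^sub>v x) a"
      using a M N x D by (simp add: scalar_prod_def atLeast0LessThan)
  qed
  also have "\<dots> \<le> vec_l2 (N *\<^sub>v x) + vec_l2 ((M - N) *\<^sub>v x)"
    using L2_set_triangle_ineq[of "vec_index (N *\<^sub>v x)" "vec_index ((M - N) *\<^sub>v x)" "{..<m}"] M N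
    by (simp add: vec_l2_def)
  also have "\<dots> \<le> spectral_norm N + (\<Sum>p\<in>{..<m} \<times> {..<l}. \<bar>(M - N) $$ p\<bar>)"
    by (intro add_mono spectral_norm_upper[OF N x] vec_l2_mult_le[OF D x])
  also have "(\<Sum>p\<in>{..<m} \<times> {..<l}. \<bar>(M - N) $$ p\<bar>) = (\<Sum>p\<in>{..<m} \<times> {..<l}. \<bar>M $$ p - N $$ p\<bar>)"
    using M N by (intro sum.cong) auto
  finally show "vec_l2 (M *\<^sub>v x) \<le> spectral_norm N + (\<Sum>p\<in>{..<m} \<times> {..<l}. \<bar>M $$ p - N $$ p\<bar>)" .
qed

lemma continuous_spectral_norm:
  "continuous_on UNIV (\<lambda>g :: nat \<times> nat \<Rightarrow> real. spectral_norm (Matrix.mat m l g))"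
  unfolding continuous_on_eq_continuous_at[OF open_UNIV]
proof
  fix g :: "nat \<times> nat \<Rightarrow> real"
  let ?d = "\<lambda>h. \<Sum>p\<in>{..<m} \<times> {..<l}. \<bar>h p - g p\<bar>"
  have "isCont ?d g"
    by (rule continuous_on_interior[of UNIV])
       (auto intro!: continuous_intros continuous_on_product_coordinates)
  then have d: "(?d \<longlongrightarrow> 0) (at g)" by (simp add: isCont_def)
  have "norm (spectral_norm (Matrix.mat m l h) - spectral_norm (Matrix.mat m l g)) \<le> ?d h" for h
  proof -
    have "(\<Sum>p\<in>{..<m} \<times> {..<l}. \<bar>Matrix.mat m l h $$ p - Matrix.mat m l g $$ p\<bar>) = ?d h"
      "(\<Sum>p\<in>{..<m} \<times> {..<l}. \<bar>Matrix.mat m l g $$ p - Matrix.mat m l h $$ p\<bar>) = ?d h"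
      by (auto intro!: sum.cong)
    then show ?thesis
      using spectral_norm_lipschitz[of "Matrix.mat m l h" m l "Matrix.mat m l g"]
        spectral_norm_lipschitz[of "Matrix.mat m l g" m l "Matrix.mat m l h"]
      by (simp add: abs_le_iff)
  qed
  then have "((\<lambda>h. spectral_norm (Matrix.mat m l h) - spectral_norm (Matrix.mat m l g)) \<longlongrightarrow> 0) (at g)"
    by (intro Lim_null_comparison[OF _ d]) auto
  then show "isCont (\<lambda>h. spectral_norm (Matrix.mat m l h)) g"
    by (simp add: isCont_def LIM_zero_iff)
qed

lemma measurable_mat_entry:
  assumes "sets \<pi> = sets (mat_borel k)" "a < k" "b < k"
  shows "(\<lambda>M. M $$ (a, b)) \<in> borel_measurable \<pi>"
proof -
  have "(\<lambda>M. restrict (($$) M) ({..<k} \<times> {..<k})) \<in>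
      mat_borel k \<rightarrow>\<^sub>M PiM ({..<k} \<times> {..<k}) (\<lambda>_. borel :: real measure)"
    unfolding mat_borel_def by (rule measurable_vimage_algebra1) (auto simp: space_PiM)
  then have "(\<lambda>M. restrict (($$) M) ({..<k} \<times> {..<k}) (a, b)) \<in> borel_measurable (mat_borel k)"
    by (rule measurable_compose) (use assms in auto)
  then show ?thesis using assms by (simp cong: measurable_cong_sets)
qed

lemma space_mat_borel:
  assumes "sets \<pi> = sets (mat_borel k)"
  shows "space \<pi> = carrier_mat k k"
  using sets_eq_imp_space_eq[OF assms] by (simp add: mat_borel_def)

lemma finite_upper_pairs: "finite (upper_pairs n)"
  by (rule finite_subset[of _ "{..<n} \<times> {..<n}"]) (auto simp: upper_pairs_def)

lemma measurable_lift_norm: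
  assumes \<pi>: "sets \<pi> = sets (mat_borel k)"
  shows "(\<lambda>\<omega>. spectral_norm (matrix_lift n k A \<omega>)) \<in> borel_measurable (sample_space n \<pi>)"
proof -
  let ?g = "\<lambda>\<omega> (r, s). if r < n * k \<and> s < n * k then matrix_lift n k A \<omega> $$ (r, s) else 0"
  have car: "\<omega> (i, j) \<in> carrier_mat k k"
    if "\<omega> \<in> space (sample_space n \<pi>)" "(i, j) \<in> upper_pairs n" for \<omega> i j
    using that space_mat_borel[OF \<pi>] by (auto simp: sample_space_def space_PiM)
  have pr: "(\<lambda>\<omega>. \<omega> (i, j) $$ (a, b)) \<in> borel_measurable (sample_space n \<pi>)"
    if "(i, j) \<in> upper_pairs n" "a < k" "b < k" for i j a b
    unfolding sample_space_def
    using measurable_compose[OF measurable_component_singleton[OF that(1), of "\<lambda>_. \<pi>"]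
        measurable_mat_entry[OF \<pi> that(2,3)]] .
  have ent: "(\<lambda>\<omega>. matrix_lift n k A \<omega> $$ (r, s)) \<in> borel_measurable (sample_space n \<pi>)"
    if rs: "r < n * k" "s < n * k" for r s
  proof -
    have k: "r mod k < k" "s mod k < k" "r div k < n" "s div k < n"
      using rs by (auto simp: less_mult_imp_div_less intro!: mod_less_divisor gr0I)
    have "(\<lambda>\<omega>. sym_sample k \<omega> (r div k) (s div k) $$ (r mod k, s mod k))
        \<in> borel_measurable (sample_space n \<pi>)"
    proof -
      consider "r div k < s div k" | "s div k < r div k" | "r div k = s div k" by linarith
      then show ?thesis
      proof cases
        case 1
        then show ?thesis using pr[of "r div k" "s div k"] k
          by (auto simp: sym_sample_def upper_pairs_def)
      next
        case 2
        then have u: "(s div k, r div k) \<in> upper_pairs n" using k by (auto simp: upper_pairs_def)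
        show ?thesis
        proof (rule measurable_cong[THEN iffD2, OF _ pr[OF u k(2,1)]])
          fix w assume "w \<in> space (sample_space n \<pi>)"
          from car[OF this u] show "sym_sample k w (r div k) (s div k) $$ (r mod k, s mod k) =
              w (s div k, r div k) $$ (s mod k, r mod k)"
            using 2 k by (simp add: sym_sample_def)
        qed
      next
        case 3
        then show ?thesis using k by (auto simp: sym_sample_def)
      qed
    qed
    then have "(\<lambda>\<omega>. A $$ (r div k, s div k) *
        sym_sample k \<omega> (r div k) (s div k) $$ (r mod k, s mod k)) \<in> borel_measurable (sample_space n \<pi>)"
      by simp
    then show ?thesis
      by (rule measurable_cong[THEN iffD2, rotated]) (use matrix_lift_index car rs in auto)
  qed
  have "?g \<in> borel_measurable (sample_space n \<pi>)"
    unfolding measurable_cong_sets[OF refl sets_PiM_equal_borel[symmetric]]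
  proof (rule measurable_PiM_single')
    fix p :: "nat \<times> nat"
    show "(\<lambda>\<omega>. ?g \<omega> p) \<in> borel_measurable (sample_space n \<pi>)"
      by (cases p; cases "fst p < n * k \<and> snd p < n * k") (auto intro: ent)
  qed auto
  from measurable_compose[OF this borel_measurable_continuous_onI[OF continuous_spectral_norm]]
  have "(\<lambda>\<omega>. spectral_norm (Matrix.mat (n * k) (n * k) (?g \<omega>))) \<in> borel_measurable (sample_space n \<pi>)" .
  moreover have "Matrix.mat (n * k) (n * k) (?g \<omega>) = matrix_lift n k A \<omega>"
    if "\<omega> \<in> space (sample_space n \<pi>)" for \<omega>
    using matrix_lift_carrier[of n \<omega> k A] car[OF that] by (intro eq_matI) auto
  ultimately show ?thesis
    by (subst measurable_cong) (auto dest!: sym)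
qed

lemma entry_le_spectral_norm:
  assumes M: "M \<in> carrier_mat m l" and a: "a < m" and b: "b < l"
  shows "\<bar>M $$ (a, b)\<bar> \<le> spectral_norm M"
proof -
  have u: "vec_l2 (unit_vec l b) \<le> 1"
  proof -
    have "(\<Sum>i<l. (vec_index (unit_vec l b) i)\<^sup>2) = (\<Sum>i<l. if i = b then 1 else (0 :: real))"
      by (rule sum.cong) (use b in \<open>auto simp: index_unit_vec\<close>)
    also have "\<dots> = 1" using b by simp
    finally show ?thesis by (simp add: vec_l2_def L2_set_def)
  qed
  have "\<bar>M $$ (a, b)\<bar> = \<bar>vec_index (M *\<^sub>v unit_vec l b) a\<bar>"
    using M a b by simp
  also have "\<dots> \<le> L2_set (\<lambda>i. \<bar>vec_index (M *\<^sub>v unit_vec l b) i\<bar>) {..<m}"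
    by (rule member_le_L2_set) (use a in auto)
  also have "\<dots> = vec_l2 (M *\<^sub>v unit_vec l b)"
    using M by (simp add: vec_l2_def L2_set_def)
  also have "\<dots> \<le> spectral_norm M"
    by (rule spectral_norm_upper[OF M _ u]) simp
  finally show ?thesis .
qed

lemma spectral_norm_nonneg:
  assumes "M \<in> carrier_mat m l"
  shows "0 \<le> spectral_norm M"
proof -
  have "0 \<le> vec_l2 (M *\<^sub>v 0\<^sub>v l)" by (simp add: vec_l2_def)
  also have "\<dots> \<le> spectral_norm M"
    by (rule spectral_norm_upper[OF assms]) (auto simp: vec_l2_def L2_set_def)
  finally show ?thesis .
qed

lemma integrable_lift_norm:
  assumes "prob_space \<pi>" and \<pi>: "sets \<pi> = sets (mat_borel k)"
    and bd: "AE M in \<pi>. spectral_norm M \<le> 1"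
  shows "integrable (sample_space n \<pi>) (\<lambda>\<omega>. spectral_norm (matrix_lift n k A \<omega>))"
proof -
  interpret S: prob_space "sample_space n \<pi>"
    unfolding sample_space_def by (rule prob_space_PiM) (rule assms)
  let ?B = "\<Sum>p\<in>{..<n * k} \<times> {..<n * k}. \<bar>A $$ (fst p div k, snd p div k)\<bar>"
  have "AE \<omega> in sample_space n \<pi>. spectral_norm (\<omega> p) \<le> 1" if "p \<in> upper_pairs n" for p
    unfolding sample_space_def by (rule AE_PiM_component[OF _ that bd]) (rule assms)
  then have "AE \<omega> in sample_space n \<pi>. \<forall>p\<in>upper_pairs n. spectral_norm (\<omega> p) \<le> 1"
    by (intro AE_finite_allI finite_upper_pairs)
  then have "AE \<omega> in sample_space n \<pi>. norm (spectral_norm (matrix_lift n k A \<omega>)) \<le> ?B"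
  proof (rule AE_mp, intro AE_I2 impI)
    fix \<omega> assume sp: "\<omega> \<in> space (sample_space n \<pi>)"
      and le: "\<forall>p\<in>upper_pairs n. spectral_norm (\<omega> p) \<le> 1"
    have car: "\<omega> (i, j) \<in> carrier_mat k k" if "(i, j) \<in> upper_pairs n" for i j
      using sp that space_mat_borel[OF \<pi>] by (auto simp: sample_space_def space_PiM)
    let ?L = "matrix_lift n k A \<omega>"
    have L: "?L \<in> carrier_mat (n * k) (n * k)"
      using car by (rule matrix_lift_carrier)
    have e: "\<bar>\<omega> (i, j) $$ (a, b)\<bar> \<le> 1" if "(i, j) \<in> upper_pairs n" "a < k" "b < k" for i j a b
      using entry_le_spectral_norm[OF car[OF that(1)] that(2,3)] le that(1) by fastforce
    have sy: "\<bar>sym_sample k \<omega> i j $$ (a, b)\<bar> \<le> 1" if "i < n" "j < n" "a < k" "b < k" for i j a b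
    proof -
      consider "i < j" | "j < i" | "i = j" by linarith
      then show ?thesis
      proof cases
        case 1
        then show ?thesis using e[of i j a b] that by (simp add: sym_sample_def upper_pairs_def)
      next
        case 2
        then have u: "(j, i) \<in> upper_pairs n" using that by (simp add: upper_pairs_def)
        from 2 show ?thesis using e[OF u that(4,3)] car[OF u] that by (simp add: sym_sample_def)
      next
        case 3
        then show ?thesis using that by (simp add: sym_sample_def)
      qed
    qed
    have "spectral_norm ?L \<le> (\<Sum>p\<in>{..<n * k} \<times> {..<n * k}. \<bar>?L $$ p\<bar>)"
      by (rule spectral_norm_least[OF L vec_l2_mult_le[OF L]])
    also have "\<dots> \<le> ?B"
    proof (rule sum_mono)
      fix p assume "p \<in> {..<n * k} \<times> {..<n * k}"
      then obtain r s where p: "p = (r, s)" "r < n * k" "s < n * k" by auto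
      have k: "r mod k < k" "s mod k < k" "r div k < n" "s div k < n"
        using p by (auto simp: less_mult_imp_div_less intro!: mod_less_divisor gr0I)
      have "\<bar>?L $$ p\<bar> = \<bar>A $$ (r div k, s div k)\<bar> *
          \<bar>sym_sample k \<omega> (r div k) (s div k) $$ (r mod k, s mod k)\<bar>"
        using matrix_lift_index[where A = A and n = n and k = k and \<omega> = \<omega>, OF car p(2,3)] by (simp add: p abs_mult)
      also have "\<dots> \<le> \<bar>A $$ (r div k, s div k)\<bar>"
        using sy[OF k(3,4,1,2)] by (intro mult_left_le) auto
      finally show "\<bar>?L $$ p\<bar> \<le> \<bar>A $$ (fst p div k, snd p div k)\<bar>" by (simp add: p)
    qed
    finally show "norm (spectral_norm ?L) \<le> ?B"
      using spectral_norm_nonneg[OF L] by simp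
  qed
  then show ?thesis
    by (rule S.integrable_const_bound) (rule measurable_lift_norm[OF \<pi>])
qed

end

theory Submission
  imports Defs
begin

text \<open>
  Moment method. Expanding the trace of an even power of the lift over closed block walks, a walk that
  traverses some edge exactly once contributes nothing because \<open>\<pi>\<close> is centered, and each of the
  others contributes at most \<open>k\<close> times the product of its \<open>\<bar>A\<^sub>i\<^sub>j\<bar>\<close>, because a product of contractions is a
  contraction. To sum the weights of the remaining walks of length \<open>2p\<close>, call an edge open between its
  first and its last traversal; every step opens an edge, closes one, or moves along an open one.
  A potential depending only on the current vertex and on the set \<open>E\<close> of open edges grows by a factor of
  at most \<open>2 (\<sigma>\<^sup>2 + p \<sigma>\<^sub>*\<^sup>2)\<^sup>1\<^sup>/\<^sup>2 + O(\<sigma>\<^sub>* p\<^sup>1\<^sup>/\<^sup>2)\<close> per step. In the potential, a vertex with \<open>c\<close> open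
  edges has weight about \<open>(c!)\<^sup>1\<^sup>/\<^sup>2\<close>, which exactly absorbs the \<open>c\<close> choices of an edge to close. Opening
  an edge to a vertex without open edges costs \<open>\<sigma>\<close> by the row bound. The other openings cost
  \<open>O(\<sigma>\<^sub>* p\<^sup>1\<^sup>/\<^sup>2)\<close> since there are at most \<open>2p\<close> open edges, and moves along open edges cost the same
  because the adjacency matrix of the open graph has Frobenius norm \<open>O(p\<^sup>1\<^sup>/\<^sup>2)\<close>.
  The theorem follows for \<open>p\<close> of order \<open>ln (k n) / ln (1 + \<epsilon>)\<close>.
\<close>

section \<open>Vertex weights\<close>

text \<open>\<open>away c\<close> is the weight of a vertex with \<open>c\<close> open edges at which the walker is not; the current
  vertex has weight \<open>away (c + 1)\<close>. The recursion makes the closing steps and the first visits neutral.\<close>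

fun away :: "nat \<Rightarrow> real" where
  "away 0 = 1"
| "away (Suc 0) = 1"
| "away (Suc (Suc c)) = (real c + 1) * away c"

lemma away_pos: "0 < away c"
  by (induction c rule: away.induct) auto

text \<open>Two-step induction along the recursion, using (c + 1)(c + 3) \<le> (c + 2)^2. The
  constant 2 is attained at c = 1.\<close>

lemma away_step_lower: "(real c + 1) * (away c)\<^sup>2 \<le> 2 * (away (Suc c))\<^sup>2"
proof (induction c rule: away.induct)
  case (3 c)
  have "(real (Suc (Suc c)) + 1) * (away (Suc (Suc c)))\<^sup>2 =
      (real c + 3) * (real c + 1) * ((real c + 1) * (away c)\<^sup>2)"
    by (simp add: power2_eq_square algebra_simps)
  also have "\<dots> \<le> (real c + 3) * (real c + 1) * (2 * (away (Suc c))\<^sup>2)"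
    by (intro mult_left_mono 3) auto
  also have "\<dots> \<le> (real c + 2)\<^sup>2 * (2 * (away (Suc c))\<^sup>2)"
    by (intro mult_right_mono) (auto simp: power2_eq_square algebra_simps)
  also have "\<dots> = 2 * (away (Suc (Suc (Suc c))))\<^sup>2"
    by (simp add: power_mult_distrib add.commute)
  finally show ?case .
qed auto

lemma away_step_upper: "(away (Suc (Suc c)))\<^sup>2 \<le> 2 * (real c + 1) * (away (Suc c))\<^sup>2"
proof -
  have "(away (Suc (Suc c)))\<^sup>2 = (real c + 1) * ((real c + 1) * (away c)\<^sup>2)"
    by (simp add: power2_eq_square algebra_simps)
  also have "\<dots> \<le> (real c + 1) * (2 * (away (Suc c))\<^sup>2)"
    by (intro mult_left_mono away_step_lower) auto
  finally show ?thesis by (simp add: algebra_simps)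
qed

text \<open>The factor that the weight of a vertex picks up when the walker stands there. The next
  bounds show that it has order sqrt c for c > 0.\<close>

definition gain :: "nat \<Rightarrow> real" where
  "gain c = away (Suc c) / away c"

lemma gain_pos: "0 < gain c"
  by (simp add: gain_def away_pos)

lemma gain_lower: "sqrt ((real c + 1) / 2) \<le> gain c"
proof (rule real_le_lsqrt)
  show "(real c + 1) / 2 \<le> (gain c)\<^sup>2"
    using away_step_lower[of c] away_pos[of c] by (simp add: gain_def power_divide field_simps)
qed (simp add: gain_pos less_imp_le)

lemma gain_upper:
  assumes "0 < c"
  shows "gain c \<le> sqrt (2 * real c)"
proof -
  obtain d where d: "c = Suc d" using assms by (cases c) auto
  have "(gain c)\<^sup>2 \<le> 2 * real c"
    using away_step_upper[of d] away_pos[of c] by (simp add: gain_def d power_divide pos_divide_le_eq algebra_simps del: away.simps)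
  then show ?thesis by (rule real_le_rsqrt)
qed

section \<open>Degrees in the graph of open edges\<close>

definition nbrs :: "nat \<Rightarrow> nat set set \<Rightarrow> nat \<Rightarrow> nat set" where
  "nbrs n E v = {w. w < n \<and> w \<noteq> v \<and> {v, w} \<in> E}"

abbreviation deg :: "nat \<Rightarrow> nat set set \<Rightarrow> nat \<Rightarrow> nat" where
  "deg n E v \<equiv> card (nbrs n E v)"

lemma finite_nbrs [simp]: "finite (nbrs n E v)"
  by (simp add: nbrs_def)

lemma deg_insert:
  assumes "u < n" "w < n" "u \<noteq> w" "{u, w} \<notin> E"
  shows "deg n (insert {u, w} E) v = deg n E v + (if v = u \<or> v = w then 1 else 0)"
proof -
  have "nbrs n (insert {u, w} E) v =
      (if v = u then insert w (nbrs n E v) else if v = w then insert u (nbrs n E v) else nbrs n E v)"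
    using assms by (auto simp: nbrs_def doubleton_eq_iff)
  moreover have "w \<notin> nbrs n E u" "u \<notin> nbrs n E w"
    using assms by (auto simp: nbrs_def insert_commute)
  ultimately show ?thesis using assms(3) by auto
qed

lemma sum_deg_insert:
  assumes "u < n" "w < n" "u \<noteq> w" "{u, w} \<notin> E"
  shows "(\<Sum>v<n. deg n (insert {u, w} E) v) = (\<Sum>v<n. deg n E v) + 2"
proof -
  have "(\<Sum>v<n. if v = u \<or> v = w then 1 else 0 :: nat) = card ({..<n} \<inter> {v. v = u \<or> v = w})"
    by (simp add: sum.If_cases)
  also have "{..<n} \<inter> {v. v = u \<or> v = w} = {u, w}"
    using assms by auto
  finally show ?thesis using assms by (simp add: deg_insert sum.distrib)
qed

text \<open>By Cauchy-Schwarz the sum of sqrt (2 deg w) is at most sqrt (deg u) * sqrt (8 p), and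
  sqrt (deg u / 2) is at most the gain at \<open>u\<close>. So the gains serve as a positive test
  vector for the adjacency matrix of the open graph.\<close>

lemma sum_gain_nbrs_le:
  assumes "u < n" "(\<Sum>w<n. deg n E w) \<le> 4 * p"
  shows "(\<Sum>w\<in>nbrs n E u. gain (deg n E w)) \<le> 4 * sqrt p * gain (deg n E u)"
proof -
  let ?B = "nbrs n E u"
  have "(\<Sum>w\<in>?B. sqrt (2 * real (deg n E w))) = (\<Sum>w\<in>?B. \<bar>1\<bar> * \<bar>sqrt (2 * real (deg n E w))\<bar>)"
    by simp
  also have "\<dots> \<le> L2_set (\<lambda>_. 1) ?B * L2_set (\<lambda>w. sqrt (2 * real (deg n E w))) ?B"
    by (rule L2_set_mult_ineq)
  also have "\<dots> = sqrt (deg n E u) * sqrt (2 * (\<Sum>w\<in>?B. deg n E w))"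
    by (simp add: L2_set_def sum_distrib_left)
  also have "(\<Sum>w\<in>?B. deg n E w) \<le> (\<Sum>w<n. deg n E w)"
    by (rule sum_mono2) (auto simp: nbrs_def)
  also note assms(2)
  finally have "(\<Sum>w\<in>?B. sqrt (2 * real (deg n E w))) \<le> sqrt (deg n E u) * sqrt (2 * real (4 * p))"
    by (simp add: mult_left_mono)
  also have "\<dots> = 4 * sqrt p * sqrt (real (deg n E u) / 2)"
  proof -
    have "sqrt (deg n E u) * sqrt (2 * real (4 * p)) = sqrt (4\<^sup>2 * real p * (real (deg n E u) / 2))"
      unfolding real_sqrt_mult[symmetric] by (rule arg_cong[of _ _ sqrt]) simp
    also have "\<dots> = sqrt (4\<^sup>2) * sqrt p * sqrt (real (deg n E u) / 2)"
      by (simp only: real_sqrt_mult)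
    finally show ?thesis by simp
  qed
  also have "\<dots> \<le> 4 * sqrt p * gain (deg n E u)"
    by (intro mult_left_mono order_trans[OF _ gain_lower]) auto
  finally have "(\<Sum>w\<in>?B. sqrt (2 * real (deg n E w))) \<le> 4 * sqrt p * gain (deg n E u)" .
  \<comment> \<open>\<open>gain_upper\<close> excludes degree 0, but a neighbour of \<open>u\<close>
    has \<open>u\<close> among its own neighbours.\<close>
  moreover have "(\<Sum>w\<in>?B. gain (deg n E w)) \<le> (\<Sum>w\<in>?B. sqrt (2 * real (deg n E w)))"
  proof (rule sum_mono, rule gain_upper)
    fix w assume "w \<in> ?B"
    then have "u \<in> nbrs n E w" using assms(1) by (auto simp: nbrs_def insert_commute)
    then show "0 < deg n E w" by (auto simp: card_gt_0_iff)
  qed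
  ultimately show ?thesis by linarith
qed

section \<open>Counting walks that traverse every edge at least twice\<close>

fun traversals :: "nat \<Rightarrow> nat list \<Rightarrow> nat set list" where
  "traversals u [] = []"
| "traversals u (w # vs) = {u, w} # traversals w vs"

fun walk_weight :: "(nat \<Rightarrow> nat \<Rightarrow> real) \<Rightarrow> nat \<Rightarrow> nat list \<Rightarrow> real" where
  "walk_weight a u [] = 1"
| "walk_weight a u (w # vs) = a u w * walk_weight a w vs"

definition walks :: "nat \<Rightarrow> nat \<Rightarrow> nat list set" where
  "walks n j = {vs. set vs \<subseteq> {..<n} \<and> length vs = j}"

lemma finite_walks [simp]: "finite (walks n j)"
  unfolding walks_def by (rule finite_lists_length_eq) simp

lemma walks_0: "walks n 0 = {[]}"
  by (auto simp: walks_def)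

lemma sum_walks_Suc: "(\<Sum>vs\<in>walks n (Suc j). f vs) = (\<Sum>w<n. \<Sum>vs\<in>walks n j. f (w # vs))"
proof -
  have "(\<Sum>vs\<in>walks n (Suc j). f vs) = (\<Sum>(w, vs)\<in>{..<n} \<times> walks n j. f (w # vs))"
  proof (rule sum.reindex_bij_witness[of _ "\<lambda>(w, vs). w # vs" "\<lambda>vs. (hd vs, tl vs)"])
  qed (auto simp: walks_def length_Suc_conv)
  then show ?thesis by (simp add: sum.cartesian_product)
qed

text \<open>The edges of \<open>E\<close> have been traversed already, so one more traversal suffices for them.\<close>

definition completes :: "nat set set \<Rightarrow> nat set list \<Rightarrow> bool" where
  "completes E es \<longleftrightarrow> (\<forall>e. if e \<in> E then count_list es e \<noteq> 0 else count_list es e \<noteq> 1)"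

lemma completes_Nil: "completes E [] \<longleftrightarrow> E = {}"
  by (auto simp: completes_def)

lemma completes_Cons_new:
  assumes "completes E (e # es)" "e \<notin> E"
  shows "completes (insert e E) es"
  unfolding completes_def
proof
  fix f
  show "if f \<in> insert e E then count_list es f \<noteq> 0 else count_list es f \<noteq> 1"
    using assms(1)[unfolded completes_def, rule_format, of f] assms(2) by (auto split: if_splits)
qed

text \<open>If \<open>e\<close> does not occur in \<open>es\<close>, this was its last traversal and
  it gets closed; otherwise it stays open.\<close>

lemma completes_Cons_old:
  assumes "completes E (e # es)" "e \<in> E"
  shows "completes E es \<or> completes (E - {e}) es"
proof (cases "count_list es e = 0")
  case True
  have "if f \<in> E - {e} then count_list es f \<noteq> 0 else count_list es f \<noteq> 1" for f
    using assms(1)[unfolded completes_def, rule_format, of f] assms(2) True by (auto split: if_splits)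
  then show ?thesis unfolding completes_def by blast
next
  case False
  have "if f \<in> E then count_list es f \<noteq> 0 else count_list es f \<noteq> 1" for f
    using assms(1)[unfolded completes_def, rule_format, of f] assms(2) False by (auto split: if_splits)
  then show ?thesis unfolding completes_def by blast
qed

section \<open>The potential and its change under one step\<close>

definition potential :: "nat \<Rightarrow> (nat set \<Rightarrow> real) \<Rightarrow> nat set set \<Rightarrow> nat \<Rightarrow> real" where
  "potential n \<theta> E u =
     (\<Prod>e\<in>E. \<theta> e) * (\<Prod>v\<in>{..<n} - {u}. away (deg n E v)) * away (Suc (deg n E u))"

lemma potential_nonneg:
  assumes "\<And>e. e \<in> E \<Longrightarrow> 0 \<le> \<theta> e"
  shows "0 \<le> potential n \<theta> E u"
  unfolding potential_def
  by (intro mult_nonneg_nonneg prod_nonneg) (use assms away_pos in \<open>auto intro: less_imp_le\<close>)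

lemma potential_split:
  assumes "u < n" "w < n" "u \<noteq> w"
  shows "potential n \<theta> E u =
    (\<Prod>e\<in>E. \<theta> e) * (\<Prod>v\<in>{..<n} - {u, w}. away (deg n E v)) * away (deg n E w) * away (Suc (deg n E u))"
proof -
  have "{..<n} - {u} = insert w ({..<n} - {u, w})" using assms by auto
  then show ?thesis by (simp add: potential_def)
qed

text \<open>Edge factors and degrees stay the same, so the step only removes a factor
  \<open>gain\<close> at \<open>u\<close> and adds one at \<open>w\<close>.\<close>

lemma potential_move:
  assumes "u < n" "w < n" "u \<noteq> w"
  shows "potential n \<theta> E w * gain (deg n E u) = potential n \<theta> E u * gain (deg n E w)"
  using assms potential_split[OF assms, of \<theta> E] potential_split[of w n u \<theta> E]
    away_pos[THEN less_imp_neq] by (simp add: gain_def insert_commute[of w u])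

text \<open>The departure from \<open>u\<close> compensates the new edge there. At \<open>w\<close>
  the argument of \<open>away\<close> grows by two, and the recursion yields the factor
  \<open>deg n E w + 1\<close>, which is 1 at a vertex without open edges.\<close>

lemma potential_open:
  assumes "u < n" "w < n" "u \<noteq> w" "{u, w} \<notin> E" "finite E"
  shows "potential n (\<theta>({u, w} := t)) (insert {u, w} E) w =
    t * (real (deg n E w) + 1) * potential n \<theta> E u"
proof -
  have "(\<Prod>e\<in>E. (\<theta>({u, w} := t)) e) = (\<Prod>e\<in>E. \<theta> e)"
    by (rule prod.cong) (use assms in auto)
  moreover have "(\<Prod>v\<in>{..<n} - {u, w}. away (deg n (insert {u, w} E) v)) =
      (\<Prod>v\<in>{..<n} - {u, w}. away (deg n E v))"
    by (rule prod.cong) (use assms in \<open>auto simp: deg_insert\<close>)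
  ultimately show ?thesis
    using assms potential_split[OF assms(1-3), of \<theta> E]
      potential_split[of w n u "\<theta>({u, w} := t)" "insert {u, w} E"]
    by (simp add: insert_commute[of w u] deg_insert)
qed

text \<open>The argument of \<open>away\<close> is unchanged at \<open>w\<close> and drops by two at
  \<open>u\<close>, which yields the factor \<open>deg n E u\<close>. This is the number of edges
  that could be closed from \<open>u\<close>, so the choice among them costs nothing.\<close>

lemma potential_close:
  assumes "u < n" "w < n" "u \<noteq> w" "{u, w} \<in> E" "finite E"
  shows "\<theta> {u, w} * potential n \<theta> (E - {{u, w}}) w * real (deg n E u) = potential n \<theta> E u"
proof -
  define F where "F = E - {{u, w}}"
  have E: "E = insert {u, w} F" "{u, w} \<notin> F" "finite F"
    using assms by (auto simp: F_def)
  have "(\<Prod>v\<in>{..<n} - {u, w}. away (deg n E v)) = (\<Prod>v\<in>{..<n} - {u, w}. away (deg n F v))"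
    by (rule prod.cong) (use assms E in \<open>auto simp: deg_insert\<close>)
  then show ?thesis
    using assms(1-3) E potential_split[OF assms(1-3), of \<theta> E] potential_split[of w n u \<theta> F]
    by (simp add: F_def[symmetric] insert_commute[of w u] deg_insert)
qed

section \<open>One-step growth of the total walk weight\<close>

locale bounded_weights =
  fixes n p :: nat and a :: "nat \<Rightarrow> nat \<Rightarrow> real" and m \<sigma> :: real
  assumes p_pos: "0 < p"
    and nonneg: "0 \<le> a i j"
    and sym: "i < n \<Longrightarrow> j < n \<Longrightarrow> a i j = a j i"
    and diag: "i < n \<Longrightarrow> a i i = 0"
    and le_max: "i < n \<Longrightarrow> j < n \<Longrightarrow> a i j \<le> m"
    and row: "i < n \<Longrightarrow> (\<Sum>j<n. (a i j)\<^sup>2) \<le> \<sigma>\<^sup>2"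
begin

text \<open>Adding p m^2 to \<sigma>^2 makes \<open>S\<close> at least m sqrt p, so that 1 / sqrt p
  is an admissible weight for every edge.\<close>

definition S :: real where
  "S = sqrt (\<sigma>\<^sup>2 + p * m\<^sup>2)"

text \<open>The sum of the costs of one step: \<open>S\<close> for closing an edge, 4 m sqrt p for
  moving along an open one, and S + 8 m sqrt p for opening one.\<close>

definition growth :: real where
  "growth = 2 * S + 12 * m * sqrt p"

text \<open>\<open>\<theta> e\<close> is the weight of an open edge \<open>e\<close> in the potential. It has to be large enough for closing \<open>e\<close>
  to cost at most \<open>S\<close>.\<close>

definition admissible :: "(nat set \<Rightarrow> real) \<Rightarrow> nat set set \<Rightarrow> bool" where
  "admissible \<theta> E \<longleftrightarrow> (\<forall>e\<in>E. 0 \<le> \<theta> e) \<and> (\<forall>u<n. \<forall>w<n. {u, w} \<in> E \<longrightarrow> a u w \<le> S * \<theta> {u, w})"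

text \<open>The last vertex is left free: the walks need not return to their start.\<close>

definition completion_weight :: "nat \<Rightarrow> nat set set \<Rightarrow> nat \<Rightarrow> real" where
  "completion_weight j E u =
     (\<Sum>vs\<in>walks n j. of_bool (completes E (traversals u vs)) * walk_weight a u vs)"

lemma S_nonneg: "0 \<le> S"
  by (simp add: S_def)

lemma S_ge: "\<bar>m\<bar> * sqrt p \<le> S"
proof -
  have "\<bar>m\<bar> * sqrt p = sqrt (p * m\<^sup>2)" by (simp add: real_sqrt_mult)
  also have "\<dots> \<le> S" unfolding S_def by (rule real_sqrt_le_mono) simp
  finally show ?thesis .
qed

lemma max_nonneg: "u < n \<Longrightarrow> 0 \<le> m"
  using nonneg[of u u] le_max[of u u] by linarith

lemma walk_weight_nonneg: "0 \<le> walk_weight a u vs"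
  by (induction vs arbitrary: u) (auto simp: nonneg)

text \<open>Split by the first step. A closed edge is forgotten and may be opened again, and an open
  edge is counted both as kept and as closed; both only enlarge the bound. A step from
  \<open>u\<close> to itself has weight 0 by \<open>diag\<close>.\<close>

lemma completion_weight_Suc:
  assumes "u < n"
  shows "completion_weight (Suc j) E u \<le>
    (\<Sum>w\<in>nbrs n E u. a u w * (completion_weight j E w + completion_weight j (E - {{u, w}}) w)) +
    (\<Sum>w\<in>{w. w < n \<and> w \<noteq> u \<and> {u, w} \<notin> E}. a u w * completion_weight j (insert {u, w} E) w)"
proof -
  let ?N = "{w. w < n \<and> w \<noteq> u \<and> {u, w} \<notin> E}"
  let ?c = "\<lambda>F w vs. of_bool (completes F (traversals w vs)) * walk_weight a w vs"
  let ?f = "\<lambda>w. a u w * (\<Sum>vs\<in>walks n j. of_bool (completes E (traversals u (w # vs))) * walk_weight a w vs)"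
  have "completion_weight (Suc j) E u = (\<Sum>w<n. ?f w)"
    unfolding completion_weight_def sum_walks_Suc
    by (intro sum.cong refl) (simp add: sum_distrib_left mult.left_commute del: sum_of_bool_mult_eq sum_mult_of_bool_eq)
  also have "\<dots> = sum ?f (nbrs n E u \<union> ?N)"
    by (rule sum.mono_neutral_right) (use assms in \<open>auto simp: nbrs_def diag\<close>)
  also have "\<dots> = sum ?f (nbrs n E u) + sum ?f ?N"
    by (rule sum.union_disjoint) (auto simp: nbrs_def)
  also have "\<dots> \<le> (\<Sum>w\<in>nbrs n E u. a u w * (completion_weight j E w + completion_weight j (E - {{u, w}}) w)) +
      (\<Sum>w\<in>?N. a u w * completion_weight j (insert {u, w} E) w)"
  proof (intro add_mono sum_mono mult_left_mono nonneg)
    fix w assume "w \<in> nbrs n E u"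
    then have e: "{u, w} \<in> E" by (simp add: nbrs_def)
    have "of_bool (completes E (traversals u (w # vs))) * walk_weight a w vs \<le> ?c E w vs + ?c (E - {{u, w}}) w vs" for vs
      using completes_Cons_old[OF _ e, of "traversals w vs"] walk_weight_nonneg[of w vs] by auto
    then show "(\<Sum>vs\<in>walks n j. of_bool (completes E (traversals u (w # vs))) * walk_weight a w vs) \<le>
        completion_weight j E w + completion_weight j (E - {{u, w}}) w"
      unfolding completion_weight_def sum.distrib[symmetric] by (intro sum_mono)
  next
    fix w assume "w \<in> ?N"
    then have e: "{u, w} \<notin> E" by simp
    have "of_bool (completes E (traversals u (w # vs))) * walk_weight a w vs \<le> ?c (insert {u, w} E) w vs" for vs
      using completes_Cons_new[OF _ e, of "traversals w vs"] walk_weight_nonneg[of w vs] by auto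
    then show "(\<Sum>vs\<in>walks n j. of_bool (completes E (traversals u (w # vs))) * walk_weight a w vs) \<le>
        completion_weight j (insert {u, w} E) w"
      unfolding completion_weight_def by (intro sum_mono)
  qed
  finally show ?thesis .
qed

text \<open>Admissibility bounds \<open>a u w\<close> by S times the edge weight, and then
  \<open>potential_close\<close> bounds each of the \<open>deg n E u\<close> summands by an equal
  share of the right-hand side.\<close>

lemma sum_close_le:
  assumes "u < n" "finite E" "admissible \<theta> E"
  shows "(\<Sum>w\<in>nbrs n E u. a u w * potential n \<theta> (E - {{u, w}}) w) \<le> S * potential n \<theta> E u"
proof (cases "deg n E u = 0")
  case True
  then show ?thesis
    using potential_nonneg[of E \<theta> n u] S_nonneg assms(3) by (auto simp: admissible_def)
next
  case False
  have "(\<Sum>w\<in>nbrs n E u. a u w * potential n \<theta> (E - {{u, w}}) w) \<le>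
      (\<Sum>w\<in>nbrs n E u. S * potential n \<theta> E u / deg n E u)"
  proof (rule sum_mono)
    fix w assume "w \<in> nbrs n E u"
    then have w: "w < n" "w \<noteq> u" "{u, w} \<in> E" by (auto simp: nbrs_def)
    have "0 \<le> potential n \<theta> (E - {{u, w}}) w"
      using assms(3) by (intro potential_nonneg) (auto simp: admissible_def)
    then have "a u w * potential n \<theta> (E - {{u, w}}) w \<le> S * \<theta> {u, w} * potential n \<theta> (E - {{u, w}}) w"
      using assms(1,3) w by (intro mult_right_mono) (auto simp: admissible_def)
    also have "\<dots> = S * potential n \<theta> E u / deg n E u"
      using potential_close[OF assms(1) w(1) w(2)[symmetric] w(3) assms(2), of \<theta>] False
      by (simp add: field_simps)
    finally show "a u w * potential n \<theta> (E - {{u, w}}) w \<le> S * potential n \<theta> E u / deg n E u" .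
  qed
  also have "\<dots> = S * potential n \<theta> E u" using False by simp
  finally show ?thesis .
qed

text \<open>By \<open>potential_move\<close> the potentials at the neighbours are proportional to
  their gains, so \<open>sum_gain_nbrs_le\<close> applies once each \<open>a u w\<close> is bounded
  by \<open>m\<close>.\<close>

lemma sum_move_le:
  assumes "u < n" "admissible \<theta> E" "(\<Sum>w<n. deg n E w) \<le> 4 * p"
  shows "(\<Sum>w\<in>nbrs n E u. a u w * potential n \<theta> E w) \<le> 4 * m * sqrt p * potential n \<theta> E u"
proof -
  have pot: "0 \<le> potential n \<theta> E w" for w
    using assms(2) by (intro potential_nonneg) (auto simp: admissible_def)
  have "(\<Sum>w\<in>nbrs n E u. a u w * potential n \<theta> E w) \<le>
      (\<Sum>w\<in>nbrs n E u. m * (potential n \<theta> E u / gain (deg n E u) * gain (deg n E w)))"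
  proof (intro sum_mono mult_mono le_max pot max_nonneg[OF assms(1)])
    fix w assume "w \<in> nbrs n E u"
    then have w: "w < n" "w \<noteq> u" by (auto simp: nbrs_def)
    show "u < n" "w < n" using assms(1) w by auto
    show "potential n \<theta> E w \<le> potential n \<theta> E u / gain (deg n E u) * gain (deg n E w)"
      using potential_move[OF assms(1) w(1) w(2)[symmetric], of \<theta> E] gain_pos[of "deg n E u"]
      by (simp add: field_simps)
  qed
  also have "\<dots> = m * (potential n \<theta> E u / gain (deg n E u)) * (\<Sum>w\<in>nbrs n E u. gain (deg n E w))"
    by (simp add: sum_distrib_left sum_divide_distrib mult_ac)
  also have "\<dots> \<le> m * (potential n \<theta> E u / gain (deg n E u)) * (4 * sqrt p * gain (deg n E u))"
    using max_nonneg[OF assms(1)] pot gain_pos[of "deg n E u"]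
    by (intro mult_left_mono sum_gain_nbrs_le assms mult_nonneg_nonneg divide_nonneg_pos)
  also have "\<dots> = 4 * m * sqrt p * potential n \<theta> E u"
    using gain_pos[of "deg n E u"] by simp
  finally show ?thesis .
qed

text \<open>Towards a vertex without open edges, the smallest admissible weight (for S > 0) makes
  opening cost a^2 / S, which the row bound controls. Elsewhere a constant suffices because the
  degree sum is bounded.\<close>

definition open_penalty :: "nat set set \<Rightarrow> nat \<Rightarrow> nat \<Rightarrow> real" where
  "open_penalty E u w = (if deg n E w = 0 then a u w / S else 1 / sqrt p)"

lemma open_penalty_admissible:
  assumes "admissible \<theta> E" "u < n" "w < n"
  shows "admissible (\<theta>({u, w} := open_penalty E u w)) (insert {u, w} E)"
proof -
  have m: "m \<le> S / sqrt p" "0 \<le> m"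
    using S_ge p_pos max_nonneg[OF assms(2)] by (auto simp: pos_le_divide_eq)
  have "a u w \<le> S * open_penalty E u w"
  \<comment> \<open>For S = 0 the quotient a / S is 0 by convention; then m = 0 and
    \<open>a u w\<close> vanishes as well.\<close>
  proof (cases "deg n E w = 0 \<and> S = 0")
    case True
    then have "m = 0" using m by simp
    then show ?thesis using True le_max[OF assms(2,3)] by (simp add: open_penalty_def)
  next
    case False
    then show ?thesis using le_max[OF assms(2,3)] m by (auto simp: open_penalty_def)
  qed
  moreover have "0 \<le> open_penalty E u w"
    by (simp add: open_penalty_def nonneg S_nonneg)
  moreover have "a w u = a u w" using sym assms by simp
  ultimately show ?thesis
    using assms unfolding admissible_def by (auto simp: doubleton_eq_iff)
qed

text \<open>The terms a^2 / S sum to at most \<sigma>^2 / S \<le> S. At vertices with open edges deg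
  + 1 \<le> 2 deg, so these contribute at most 2 m / sqrt p times the degree sum.\<close>

lemma sum_open_le:
  assumes "u < n" "(\<Sum>w<n. deg n E w) \<le> 4 * p"
  shows "(\<Sum>w<n. a u w * (open_penalty E u w * (real (deg n E w) + 1))) \<le> S + 8 * m * sqrt p"
proof -
  have m: "0 \<le> m" using max_nonneg assms(1) by blast
  have "(\<Sum>w<n. a u w * (open_penalty E u w * (real (deg n E w) + 1))) \<le>
      (\<Sum>w<n. (a u w)\<^sup>2 / S + 2 * m / sqrt p * deg n E w)"
  proof (rule sum_mono)
    fix w assume "w \<in> {..<n}"
    then have w: "w < n" by simp
    show "a u w * (open_penalty E u w * (real (deg n E w) + 1)) \<le> (a u w)\<^sup>2 / S + 2 * m / sqrt p * deg n E w"
    proof (cases "deg n E w = 0")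
      case True
      then show ?thesis by (simp add: open_penalty_def power2_eq_square)
    next
      case False
      then have "1 \<le> deg n E w" by linarith
      then have "a u w * (real (deg n E w) + 1) \<le> m * (2 * real (deg n E w))"
        using le_max[OF assms(1) w] m by (intro mult_mono) auto
      then have "a u w * (real (deg n E w) + 1) / sqrt p \<le> m * (2 * real (deg n E w)) / sqrt p"
        by (intro divide_right_mono) auto
      then have "a u w * (open_penalty E u w * (real (deg n E w) + 1)) \<le> 2 * m / sqrt p * deg n E w"
        using False by (simp add: open_penalty_def mult_ac)
      moreover have "0 \<le> (a u w)\<^sup>2 / S" using S_nonneg by simp
      ultimately show ?thesis by linarith
    qed
  qed
  also have "\<dots> = (\<Sum>w<n. (a u w)\<^sup>2) / S + 2 * m / sqrt p * real (\<Sum>w<n. deg n E w)"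
    by (simp add: sum.distrib sum_divide_distrib sum_distrib_left)
  also have "\<dots> \<le> S\<^sup>2 / S + 2 * m / sqrt p * real (4 * p)"
  proof (intro add_mono divide_right_mono mult_left_mono)
    show "(\<Sum>w<n. (a u w)\<^sup>2) \<le> S\<^sup>2" using row[OF assms(1)] by (simp add: S_def add_increasing2)
    show "real (\<Sum>w<n. deg n E w) \<le> real (4 * p)" using assms(2) by (simp only: of_nat_le_iff)
  qed (use m S_nonneg in auto)
  also have "\<dots> = S + 8 * m * (p / sqrt p)"
    by (simp add: power2_eq_square)
  also have "\<dots> = S + 8 * m * sqrt p"
    by (simp only: real_div_sqrt of_nat_0_le_iff)
  finally show ?thesis .
qed

text \<open>Opening an edge adds 2 to the degree sum and uses up one step, so the budget in the last
  hypothesis persists and the degree sum stays at most 4 p. The edge weights are generalized in the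
  induction because each opening sets the weight of its edge.\<close>

lemma completion_weight_le:
  assumes "finite E" "u < n" "admissible \<theta> E" "(\<Sum>v<n. deg n E v) + 2 * j \<le> 4 * p"
  shows "completion_weight j E u \<le> growth ^ j * potential n \<theta> E u"
  using assms
proof (induction j arbitrary: E u \<theta>)
  case 0
  have "0 \<le> potential n \<theta> E u"
    using 0 by (intro potential_nonneg) (auto simp: admissible_def)
  moreover have "potential n \<theta> {} u = 1"
    by (simp add: potential_def nbrs_def)
  ultimately show ?case
    by (simp add: completion_weight_def walks_0 completes_Nil)
next
  case (Suc j)
  note u = \<open>u < n\<close>
  let ?P = "potential n \<theta> E u"
  let ?N = "{w. w < n \<and> w \<noteq> u \<and> {u, w} \<notin> E}"
  have P: "0 \<le> ?P"
    using Suc.prems by (intro potential_nonneg) (auto simp: admissible_def)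
  have deg: "(\<Sum>v<n. deg n E v) \<le> 4 * p" using Suc.prems by simp
  have m: "0 \<le> m" using max_nonneg u by blast
  have "completion_weight (Suc j) E u \<le>
    (\<Sum>w\<in>nbrs n E u. a u w * (completion_weight j E w + completion_weight j (E - {{u, w}}) w)) +
    (\<Sum>w\<in>?N. a u w * completion_weight j (insert {u, w} E) w)"
    by (rule completion_weight_Suc[OF u])
  also have "\<dots> \<le>
    (\<Sum>w\<in>nbrs n E u. a u w * (growth ^ j * potential n \<theta> E w + growth ^ j * potential n \<theta> (E - {{u, w}}) w)) +
    (\<Sum>w\<in>?N. a u w * (growth ^ j * (open_penalty E u w * (real (deg n E w) + 1) * ?P)))"
  proof (intro add_mono sum_mono mult_left_mono nonneg)
    fix w assume "w \<in> nbrs n E u"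
    then have w: "w < n" "w \<noteq> u" "{u, w} \<in> E" by (auto simp: nbrs_def)
    show "completion_weight j E w \<le> growth ^ j * potential n \<theta> E w"
      using Suc w by simp
    have "(\<Sum>v<n. deg n (E - {{u, w}}) v) \<le> (\<Sum>v<n. deg n E v)"
      by (intro sum_mono card_mono) (auto simp: nbrs_def)
    moreover have "admissible \<theta> (E - {{u, w}})"
      using Suc.prems by (auto simp: admissible_def)
    ultimately show "completion_weight j (E - {{u, w}}) w \<le> growth ^ j * potential n \<theta> (E - {{u, w}}) w"
      using Suc.prems w by (intro Suc.IH) auto
  next
    fix w assume "w \<in> ?N"
    then have w: "w < n" "u \<noteq> w" "{u, w} \<notin> E" by auto
    have "completion_weight j (insert {u, w} E) w \<le>
        growth ^ j * potential n (\<theta>({u, w} := open_penalty E u w)) (insert {u, w} E) w"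
      using Suc.prems w by (intro Suc.IH open_penalty_admissible) (auto simp: sum_deg_insert)
    then show "completion_weight j (insert {u, w} E) w \<le>
        growth ^ j * (open_penalty E u w * (real (deg n E w) + 1) * ?P)"
      using potential_open[OF u w(1-3) Suc.prems(1)] by simp
  qed
  also have "\<dots> = growth ^ j *
     ((\<Sum>w\<in>nbrs n E u. a u w * potential n \<theta> E w) +
      (\<Sum>w\<in>nbrs n E u. a u w * potential n \<theta> (E - {{u, w}}) w) +
      (\<Sum>w\<in>?N. a u w * (open_penalty E u w * (real (deg n E w) + 1))) * ?P)"
    by (simp add: algebra_simps sum.distrib sum_distrib_left sum_distrib_right)
  also have "\<dots> \<le> growth ^ j * (4 * m * sqrt p * ?P + S * ?P + (S + 8 * m * sqrt p) * ?P)"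
  proof (intro mult_left_mono add_mono mult_right_mono)
    show "(\<Sum>w\<in>nbrs n E u. a u w * potential n \<theta> E w) \<le> 4 * m * sqrt p * ?P"
      by (rule sum_move_le[OF u Suc.prems(3) deg])
    show "(\<Sum>w\<in>nbrs n E u. a u w * potential n \<theta> (E - {{u, w}}) w) \<le> S * ?P"
      by (rule sum_close_le[OF u Suc.prems(1,3)])
    have "(\<Sum>w\<in>?N. a u w * (open_penalty E u w * (real (deg n E w) + 1))) \<le>
        (\<Sum>w<n. a u w * (open_penalty E u w * (real (deg n E w) + 1)))"
      by (rule sum_mono2) (auto simp: open_penalty_def nonneg S_nonneg)
    then show "(\<Sum>w\<in>?N. a u w * (open_penalty E u w * (real (deg n E w) + 1))) \<le> S + 8 * m * sqrt p"
      using sum_open_le[OF u deg] by linarith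
    show "0 \<le> growth ^ j" using m S_nonneg by (simp add: growth_def)
  qed (use P in auto)
  also have "\<dots> = growth ^ Suc j * ?P" by (simp add: growth_def algebra_simps)
  finally show ?case .
qed

text \<open>Without open edges the potential is 1, and 2 p steps exactly fill the degree budget 4
  p.\<close>

lemma sum_closed_walks_le:
  assumes "u < n"
  shows "(\<Sum>vs\<in>walks n (2 * p). of_bool (completes {} (traversals u vs)) * walk_weight a u vs) \<le> growth ^ (2 * p)"
proof -
  have "admissible (\<lambda>_. 0) {}" by (simp add: admissible_def)
  from completion_weight_le[OF _ assms this, of "2 * p"] show ?thesis
    by (simp add: completion_weight_def potential_def nbrs_def)
qed

end

section \<open>The spectral norm and powers of symmetric matrices\<close>

lemma vec_l2_sq: "(vec_l2 x)\<^sup>2 = x \<bullet> x"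
  by (simp add: vec_l2_def L2_set_def scalar_prod_def power2_eq_square sum_nonneg atLeast0LessThan)

lemma vec_l2_nonneg: "0 \<le> vec_l2 x"
  by (simp add: vec_l2_def)

lemma scalar_prod_le_vec_l2:
  assumes "dim_vec x = dim_vec y"
  shows "x \<bullet> y \<le> vec_l2 x * vec_l2 y"
proof -
  have "x \<bullet> y \<le> (\<Sum>i<dim_vec y. \<bar>vec_index x i\<bar> * \<bar>vec_index y i\<bar>)"
    unfolding scalar_prod_def atLeast0LessThan by (intro sum_mono) (metis abs_ge_self abs_mult)
  also have "\<dots> \<le> vec_l2 x * vec_l2 y"
    unfolding vec_l2_def assms by (rule L2_set_mult_ineq)
  finally show ?thesis .
qed

lemma mult_pow_mat_commute:
  fixes M :: "'a :: comm_semiring_1 mat"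
  assumes "M \<in> carrier_mat N N"
  shows "M * M ^\<^sub>m t = M ^\<^sub>m t * M"
proof (induction t)
  case (Suc t)
  have "M * M ^\<^sub>m Suc t = (M * M ^\<^sub>m t) * M"
    using assms by (simp add: assoc_mult_mat[symmetric, of M N N _ N M N])
  then show ?case by (simp add: Suc)
qed (use assms in auto)

lemma pow_mat_Suc_left:
  fixes M :: "'a :: comm_semiring_1 mat"
  assumes "M \<in> carrier_mat N N"
  shows "M ^\<^sub>m Suc t = M * M ^\<^sub>m t"
  using mult_pow_mat_commute[OF assms] by simp

lemma pow_mat_add:
  fixes M :: "'a :: comm_semiring_1 mat"
  assumes "M \<in> carrier_mat N N"
  shows "M ^\<^sub>m (s + t) = M ^\<^sub>m s * M ^\<^sub>m t"
proof (induction t)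
  case (Suc t)
  then show ?case
    using assms by (simp add: assoc_mult_mat[of _ N N _ N M N])
qed (use assms in auto)

lemma transpose_pow_mat:
  fixes M :: "'a :: comm_semiring_1 mat"
  assumes "M \<in> carrier_mat N N" "transpose_mat M = M"
  shows "transpose_mat (M ^\<^sub>m t) = M ^\<^sub>m t"
proof (induction t)
  case (Suc t)
  then show ?case
    using assms mult_pow_mat_commute[OF assms(1), of t]
    by (simp add: transpose_mult[of _ N N M N])
qed (use assms in auto)

text \<open>The norms of the vectors \<open>M\<^sup>t x\<close> form a log-convex sequence when \<open>M\<close> is symmetric.\<close>

lemma vec_l2_mult_power_le:
  assumes M: "M \<in> carrier_mat N N" "transpose_mat M = M"
    and x: "x \<in> carrier_vec N" "vec_l2 x \<le> 1"
    and t: "0 < t"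
  shows "vec_l2 (M *\<^sub>v x) ^ t \<le> vec_l2 (M ^\<^sub>m t *\<^sub>v x)"
proof -
  define b where "b t = vec_l2 (M ^\<^sub>m t *\<^sub>v x)" for t
  have b0: "b 0 \<le> 1" "b 1 = vec_l2 (M *\<^sub>v x)" and nn: "0 \<le> b t" for t
    using M x by (auto simp: b_def vec_l2_nonneg)
  \<comment> \<open>Symmetry moves one factor \<open>M\<close> across the scalar product, and
    Cauchy-Schwarz then gives log-convexity.\<close>
  have cx: "(b (Suc t))\<^sup>2 \<le> b t * b (Suc (Suc t))" for t
  proof -
    let ?v = "M ^\<^sub>m t *\<^sub>v x"
    have v: "?v \<in> carrier_vec N" using M x by (intro mult_mat_vec_carrier) auto
    have 1: "M ^\<^sub>m Suc t *\<^sub>v x = M *\<^sub>v ?v"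
      unfolding pow_mat_Suc_left[OF M(1)] using M x by (intro assoc_mult_mat_vec) auto
    have 2: "M ^\<^sub>m Suc (Suc t) *\<^sub>v x = M *\<^sub>v (M *\<^sub>v ?v)"
      unfolding pow_mat_Suc_left[OF M(1), of "Suc t"] 1[symmetric]
      using M x by (intro assoc_mult_mat_vec) auto
    have "(b (Suc t))\<^sup>2 = (M *\<^sub>v ?v) \<bullet> (M *\<^sub>v ?v)"
      unfolding b_def 1 by (rule vec_l2_sq)
    also have "\<dots> = ?v \<bullet> (M *\<^sub>v (M *\<^sub>v ?v))"
      using transpose_vec_mult_scalar[OF M(1) v, of "M *\<^sub>v ?v"] M v
      by (simp add: comm_scalar_prod[of _ N])
    also have "\<dots> \<le> b t * b (Suc (Suc t))"
      unfolding b_def 2 using M v by (intro scalar_prod_le_vec_l2) auto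
    finally show ?thesis .
  qed
  show ?thesis
  proof (cases "b 1 = 0")
    case True
    then show ?thesis using b0 t vec_l2_nonneg by (cases t) auto
  next
    case False
    \<comment> \<open>The ratios of consecutive norms increase, and the first is at least
      \<open>b 1\<close> because \<open>b 0\<close> is at most 1. Positivity is carried along so
      that \<open>b t\<close> can be cancelled.\<close>
    have step: "b 1 * b t \<le> b (Suc t) \<and> 0 < b (Suc t)" for t
    proof (induction t)
      case 0
      then show ?case using b0 nn[of 1] False by (simp add: mult_left_le)
    next
      case (Suc t)
      have "b 1 * b t * b (Suc t) \<le> (b (Suc t))\<^sup>2"
        using Suc by (simp add: power2_eq_square mult_right_mono)
      also note cx[of t]
      finally have *: "b t * (b 1 * b (Suc t)) \<le> b t * b (Suc (Suc t))" by (simp add: mult_ac)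
      have "0 < b t * b (Suc (Suc t))"
        using cx[of t] Suc zero_less_power[of "b (Suc t)" 2] by linarith
      then have "0 < b t" "0 < b (Suc (Suc t))"
        using nn[of t] nn[of "Suc (Suc t)"] by (auto simp: zero_less_mult_iff)
      then show ?case using * by (simp add: mult_le_cancel_left_pos)
    qed
    have "b 1 ^ Suc t \<le> b (Suc t)" for t
    proof (induction t)
      case (Suc t)
      have "b 1 ^ Suc (Suc t) \<le> b 1 * b (Suc t)"
        using Suc nn[of 1] by (simp add: mult_left_mono)
      then show ?case using step[of "Suc t"] by linarith
    qed simp
    then show ?thesis using b0 t by (cases t) (auto simp: b_def)
  qed
qed

lemma vec_l2_mult_frobenius:
  assumes M: "M \<in> carrier_mat N N" and x: "x \<in> carrier_vec N" "vec_l2 x \<le> 1"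
  shows "(vec_l2 (M *\<^sub>v x))\<^sup>2 \<le> (\<Sum>r<N. \<Sum>s<N. (M $$ (r, s))\<^sup>2)"
proof -
  have "(vec_l2 (M *\<^sub>v x))\<^sup>2 = (\<Sum>r<N. (\<Sum>s<N. M $$ (r, s) * vec_index x s)\<^sup>2)"
    using M x by (simp add: vec_l2_def L2_set_def sum_nonneg scalar_prod_def atLeast0LessThan)
  also have "\<dots> \<le> (\<Sum>r<N. \<Sum>s<N. (M $$ (r, s))\<^sup>2)"
  proof (rule sum_mono)
    fix r
    have "(\<Sum>s<N. (vec_index x s)\<^sup>2) = (vec_l2 x)\<^sup>2"
      using x by (simp add: vec_l2_def L2_set_def sum_nonneg)
    also have "\<dots> \<le> 1" using x vec_l2_nonneg[of x] by (simp add: power_le_one)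
    finally have "(\<Sum>s<N. (vec_index x s)\<^sup>2) \<le> 1" .
    then have "(\<Sum>s<N. (M $$ (r, s))\<^sup>2) * (\<Sum>s<N. (vec_index x s)\<^sup>2) \<le> (\<Sum>s<N. (M $$ (r, s))\<^sup>2)"
      by (intro mult_left_le) (auto intro: sum_nonneg)
    then show "(\<Sum>s<N. M $$ (r, s) * vec_index x s)\<^sup>2 \<le> (\<Sum>s<N. (M $$ (r, s))\<^sup>2)"
      using Cauchy_Schwarz_ineq_sum[of "\<lambda>s. M $$ (r, s)" "vec_index x" "{..<N}"] by linarith
  qed
  finally show ?thesis .
qed

text \<open>The trace of M^(2p) is the squared Frobenius norm of M^p, which dominates |M^p x|^2 and
  hence, by log-convexity, |M x|^(2p) for x in the unit ball.\<close>

lemma spectral_norm_power_le_trace: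
  assumes M: "M \<in> carrier_mat N N" "transpose_mat M = M" and "0 < p"
  shows "spectral_norm M ^ (2 * p) \<le> (\<Sum>r<N. (M ^\<^sub>m (2 * p)) $$ (r, r))"
proof -
  let ?T = "\<Sum>r<N. (M ^\<^sub>m (2 * p)) $$ (r, r)"
  have sy: "(M ^\<^sub>m p) $$ (s, r) = (M ^\<^sub>m p) $$ (r, s)" if "r < N" "s < N" for r s
    using transpose_pow_mat[OF M, of p] index_transpose_mat(1)[of r "M ^\<^sub>m p" s] M that by simp
  have T: "?T = (\<Sum>r<N. \<Sum>s<N. ((M ^\<^sub>m p) $$ (r, s))\<^sup>2)"
    using M sy by (simp add: mult_2 pow_mat_add[OF M(1)] scalar_prod_def atLeast0LessThan power2_eq_square)
  then have T0: "0 \<le> ?T" by (simp add: sum_nonneg)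
  have "spectral_norm M \<le> root (2 * p) ?T"
  proof (rule spectral_norm_least[OF M(1)])
    fix x assume x: "x \<in> carrier_vec N" "vec_l2 x \<le> 1"
    have "vec_l2 (M *\<^sub>v x) ^ (2 * p) = (vec_l2 (M *\<^sub>v x) ^ p)\<^sup>2"
      by (simp add: power_mult[symmetric] mult.commute)
    also have "\<dots> \<le> (vec_l2 (M ^\<^sub>m p *\<^sub>v x))\<^sup>2"
      using vec_l2_mult_power_le[OF M x assms(3)] by (intro power_mono) (auto simp: vec_l2_nonneg)
    also have "\<dots> \<le> ?T"
      unfolding T using M x by (intro vec_l2_mult_frobenius) auto
    finally have "vec_l2 (M *\<^sub>v x) ^ (2 * p) \<le> ?T" .
    then show "vec_l2 (M *\<^sub>v x) \<le> root (2 * p) ?T"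
      using assms(3) vec_l2_nonneg by (metis mult_pos_pos pos2 real_root_le_iff real_root_power_cancel)
  qed
  then have "spectral_norm M ^ (2 * p) \<le> root (2 * p) ?T ^ (2 * p)"
    by (intro power_mono spectral_norm_nonneg[OF M(1)])
  also have "\<dots> = ?T" using assms(3) T0 by (simp add: real_root_pow_pos2)
  finally show ?thesis .
qed

section \<open>Contractions and their transposes\<close>

lemma vec_l2_mult_le_spectral_norm:
  assumes M: "M \<in> carrier_mat m l" and x: "x \<in> carrier_vec l"
  shows "vec_l2 (M *\<^sub>v x) \<le> spectral_norm M * vec_l2 x"
proof (cases "vec_l2 x = 0")
  case True
  have "vec_index x i = 0" if "i < l" for i
    using True that x by (simp add: vec_l2_def L2_set_eq_0_iff)
  then have "x = 0\<^sub>v l" using x by (intro eq_vecI) auto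
  then have "M *\<^sub>v x = 0\<^sub>v m" using M by (intro eq_vecI) auto
  then show ?thesis using True by (simp add: vec_l2_def L2_set_def)
next
  case False
  then have p: "0 < vec_l2 x" using vec_l2_nonneg[of x] by linarith
  have sc: "vec_l2 (c \<cdot>\<^sub>v v) = \<bar>c\<bar> * vec_l2 v" for c v
    by (simp add: vec_l2_def L2_set_def power_mult_distrib sum_distrib_left[symmetric] real_sqrt_mult)
  have "vec_l2 (M *\<^sub>v ((1 / vec_l2 x) \<cdot>\<^sub>v x)) \<le> spectral_norm M"
    using x p by (intro spectral_norm_upper[OF M]) (auto simp: sc)
  also have "M *\<^sub>v ((1 / vec_l2 x) \<cdot>\<^sub>v x) = (1 / vec_l2 x) \<cdot>\<^sub>v (M *\<^sub>v x)"
    by (rule mult_mat_vec[OF M x])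
  finally show ?thesis using p by (simp add: sc field_simps)
qed

lemma spectral_norm_le_1_contraction:
  assumes "M \<in> carrier_mat k k" "spectral_norm M \<le> 1"
  shows "(\<Sum>a<k. (\<Sum>c<k. M $$ (a, c) * y c)\<^sup>2) \<le> (\<Sum>c<k. (y c)\<^sup>2)"
proof -
  let ?y = "Matrix.vec k y"
  have "vec_l2 (M *\<^sub>v ?y) \<le> spectral_norm M * vec_l2 ?y"
    using assms by (intro vec_l2_mult_le_spectral_norm) auto
  also have "\<dots> \<le> 1 * vec_l2 ?y"
    by (intro mult_right_mono assms vec_l2_nonneg)
  finally have "(vec_l2 (M *\<^sub>v ?y))\<^sup>2 \<le> (vec_l2 ?y)\<^sup>2"
    by (intro power_mono vec_l2_nonneg) simp
  then show ?thesis
    using assms(1) by (simp add: vec_l2_def L2_set_def sum_nonneg scalar_prod_def atLeast0LessThan)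
qed

text \<open>For z the transpose applied to y, |z|^2 = <y, M z> \<le> |y| |z|, and |z| cancels. This
  covers the blocks below the diagonal.\<close>

lemma contraction_transpose:
  fixes M :: "nat \<Rightarrow> nat \<Rightarrow> real"
  assumes "\<And>y. (\<Sum>a<k. (\<Sum>c<k. M a c * y c)\<^sup>2) \<le> (\<Sum>c<k. (y c)\<^sup>2)"
  shows "(\<Sum>a<k. (\<Sum>c<k. M c a * y c)\<^sup>2) \<le> (\<Sum>c<k. (y c)\<^sup>2)"
proof -
  define z where "z a = (\<Sum>c<k. M c a * y c)" for a
  define Z where "Z = (\<Sum>a<k. (z a)\<^sup>2)"
  have Z0: "0 \<le> Z" by (simp add: Z_def sum_nonneg)
  have "Z = (\<Sum>a<k. \<Sum>c<k. M c a * y c * z a)"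
    by (simp add: Z_def power2_eq_square z_def sum_distrib_right)
  also have "\<dots> = (\<Sum>c<k. y c * (\<Sum>a<k. M c a * z a))"
    by (subst sum.swap) (simp add: sum_distrib_left mult_ac)
  finally have "Z\<^sup>2 \<le> (\<Sum>c<k. (y c)\<^sup>2) * (\<Sum>c<k. (\<Sum>a<k. M c a * z a)\<^sup>2)"
    using Cauchy_Schwarz_ineq_sum[of y "\<lambda>c. \<Sum>a<k. M c a * z a" "{..<k}"] by simp
  also have "\<dots> \<le> (\<Sum>c<k. (y c)\<^sup>2) * Z"
    unfolding Z_def by (intro mult_left_mono assms sum_nonneg) auto
  finally have "Z * Z \<le> (\<Sum>c<k. (y c)\<^sup>2) * Z" by (simp add: power2_eq_square)
  then have "Z \<le> (\<Sum>c<k. (y c)\<^sup>2)"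
    using Z0 by (cases "Z = 0") (auto intro: sum_nonneg)
  then show ?thesis by (simp add: Z_def z_def)
qed

section \<open>The trace moments of the lift\<close>

text \<open>Swapping indices in place of \<open>transpose_mat\<close> keeps the formula independent
  of the dimensions of the samples, so that an arbitrary \<open>M\<close> can be substituted in
  \<open>walk_block_linear\<close>.\<close>

definition block :: "(nat \<times> nat \<Rightarrow> real Matrix.mat) \<Rightarrow> nat \<Rightarrow> nat \<Rightarrow> nat \<Rightarrow> nat \<Rightarrow> real" where
  "block \<omega> i j a c = (if i < j then \<omega> (i, j) $$ (a, c) else if j < i then \<omega> (j, i) $$ (c, a) else 0)"

text \<open>An entry of the product of the blocks met along the walk.\<close>

fun walk_block :: "nat \<Rightarrow> (nat \<times> nat \<Rightarrow> real Matrix.mat) \<Rightarrow> nat \<Rightarrow> nat list \<Rightarrow> nat \<Rightarrow> nat \<Rightarrow> real" where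
  "walk_block k \<omega> u [] a b = of_bool (a = b)"
| "walk_block k \<omega> u (w # vs) a b = (\<Sum>c<k. block \<omega> u w a c * walk_block k \<omega> w vs c b)"

lemma sum_lessThan_mult:
  fixes f :: "nat \<Rightarrow> 'a :: comm_monoid_add"
  shows "(\<Sum>s<n * k. f s) = (\<Sum>w<n. \<Sum>c<k. f (w * k + c))"
proof -
  have "(\<Sum>s<n * k. f s) = (\<Sum>w<n. sum f {w * k..<w * k + k})"
    by (rule sum.nat_group[symmetric])
  also have "\<dots> = (\<Sum>w<n. \<Sum>c<k. f (w * k + c))"
  proof (rule sum.cong[OF refl])
    fix w
    show "sum f {w * k..<w * k + k} = (\<Sum>c<k. f (w * k + c))"
      using sum.shift_bounds_nat_ivl[of f 0 "w * k" k] by (simp add: add.commute atLeast0LessThan)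
  qed
  finally show ?thesis .
qed

lemma block_index_less:
  assumes "u < n" "a < k"
  shows "u * k + a < n * (k :: nat)"
proof -
  have "u * k + a < Suc u * k" using assms by simp
  also have "\<dots> \<le> n * k" using assms by (intro mult_right_mono) auto
  finally show ?thesis .
qed

lemma sym_sample_index:
  assumes "\<And>i j. (i, j) \<in> upper_pairs n \<Longrightarrow> \<omega> (i, j) \<in> carrier_mat k k" "i < n" "j < n" "a < k" "c < k"
  shows "sym_sample k \<omega> i j $$ (a, c) = block \<omega> i j a c"
  using assms(1)[of j i] assms(2-) by (auto simp: sym_sample_def block_def upper_pairs_def)

lemma block_sym: "block \<omega> i j a c = block \<omega> j i c a"
  by (auto simp: block_def)

lemma transpose_matrix_lift:
  assumes car: "\<And>i j. (i, j) \<in> upper_pairs n \<Longrightarrow> \<omega> (i, j) \<in> carrier_mat k k"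
    and A: "A \<in> carrier_mat n n" "transpose_mat A = A"
  shows "transpose_mat (matrix_lift n k A \<omega>) = matrix_lift n k A \<omega>"
proof -
  have L: "matrix_lift n k A \<omega> \<in> carrier_mat (n * k) (n * k)"
    using car by (rule matrix_lift_carrier)
  note index = matrix_lift_index[where n = n and k = k and \<omega> = \<omega> and A = A, OF car]
    sym_sample_index[where n = n and k = k and \<omega> = \<omega>, OF car]
  have A': "A $$ (j, i) = A $$ (i, j)" if "i < n" "j < n" for i j
    using index_transpose_mat(1)[of i A j] A that by simp
  have "matrix_lift n k A \<omega> $$ (s, r) = matrix_lift n k A \<omega> $$ (r, s)" if "r < n * k" "s < n * k" for r s
  proof -
    have k: "r mod k < k" "s mod k < k" "r div k < n" "s div k < n"
      using that by (auto simp: less_mult_imp_div_less intro!: mod_less_divisor gr0I)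
    show ?thesis
      using that k car A' block_sym[of \<omega> "s div k"]
      by (simp add: index)
  qed
  then show ?thesis using L by (intro eq_matI) auto
qed

text \<open>Split off the first factor and write its column as w * k + c: the vertex
  \<open>w\<close> extends the walk, and the sum over \<open>c\<close> is the block product.\<close>

lemma matrix_lift_power_index:
  assumes car: "\<And>i j. (i, j) \<in> upper_pairs n \<Longrightarrow> \<omega> (i, j) \<in> carrier_mat k k"
    and "u < n" "a < k" "z < n" "b < k"
  shows "(matrix_lift n k A \<omega> ^\<^sub>m t) $$ (u * k + a, z * k + b) =
    (\<Sum>vs\<in>walks n t. of_bool (last (u # vs) = z) *
      (walk_weight (\<lambda>i j. A $$ (i, j)) u vs * walk_block k \<omega> u vs a b))"
  using assms(2,3)
proof (induction t arbitrary: u a)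
  case 0
  have L: "matrix_lift n k A \<omega> \<in> carrier_mat (n * k) (n * k)"
    using car by (rule matrix_lift_carrier)
  have "u * k + a = z * k + b \<longleftrightarrow> u = z \<and> a = b"
  proof
    assume "u * k + a = z * k + b"
    then have "(u * k + a) div k = (z * k + b) div k" "(u * k + a) mod k = (z * k + b) mod k" by auto
    then show "u = z \<and> a = b" using 0 assms by simp
  qed auto
  then show ?case
    using L block_index_less[OF 0] block_index_less[OF assms(4,5)] by (simp add: walks_0)
next
  case (Suc t)
  let ?L = "matrix_lift n k A \<omega>"
  let ?A = "\<lambda>i j. A $$ (i, j)"
  note index = matrix_lift_index[where n = n and k = k and \<omega> = \<omega> and A = A, OF car]
    sym_sample_index[where n = n and k = k and \<omega> = \<omega>, OF car]
  have L: "?L \<in> carrier_mat (n * k) (n * k)"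
    using car by (rule matrix_lift_carrier)
  have "(?L ^\<^sub>m Suc t) $$ (u * k + a, z * k + b) =
      (\<Sum>s<n * k. ?L $$ (u * k + a, s) * (?L ^\<^sub>m t) $$ (s, z * k + b))"
    unfolding pow_mat_Suc_left[OF L]
    using L block_index_less[OF Suc.prems] block_index_less[OF assms(4,5)]
    by (simp add: scalar_prod_def atLeast0LessThan)
  also have "\<dots> = (\<Sum>w<n. \<Sum>c<k. ?L $$ (u * k + a, w * k + c) * (?L ^\<^sub>m t) $$ (w * k + c, z * k + b))"
    by (rule sum_lessThan_mult)
  also have "\<dots> = (\<Sum>w<n. \<Sum>c<k. A $$ (u, w) * block \<omega> u w a c *
      (\<Sum>vs\<in>walks n t. of_bool (last (w # vs) = z) * (walk_weight ?A w vs * walk_block k \<omega> w vs c b)))"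
  proof (intro sum.cong refl arg_cong2[of _ _ _ _ "(*)"])
    fix w c assume "w \<in> {..<n}" "c \<in> {..<k}"
    then have w: "w < n" "c < k" by auto
    show "?L $$ (u * k + a, w * k + c) = A $$ (u, w) * block \<omega> u w a c"
      using w Suc.prems block_index_less[OF Suc.prems] block_index_less[OF w]
      by (simp add: index)
    show "(?L ^\<^sub>m t) $$ (w * k + c, z * k + b) = (\<Sum>vs\<in>walks n t. of_bool (last (w # vs) = z) *
        (walk_weight ?A w vs * walk_block k \<omega> w vs c b))"
      using Suc.IH w by simp
  qed
  also have "\<dots> = (\<Sum>w<n. \<Sum>vs\<in>walks n t. \<Sum>c<k. A $$ (u, w) * block \<omega> u w a c *
      (of_bool (last (w # vs) = z) * (walk_weight ?A w vs * walk_block k \<omega> w vs c b)))"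
    unfolding sum_distrib_left by (intro sum.cong refl sum.swap)
  also have "\<dots> = (\<Sum>w<n. \<Sum>vs\<in>walks n t. of_bool (last (u # w # vs) = z) *
      (walk_weight ?A u (w # vs) * walk_block k \<omega> u (w # vs) a b))"
    by (intro sum.cong refl) (simp add: sum_distrib_left mult_ac)
  finally show ?case by (simp only: sum_walks_Suc)
qed

section \<open>Dependence of a walk product on a single sample\<close>

lemma block_upd_other:
  assumes "x < y" "{u, w} \<noteq> {x, y}"
  shows "block (fun_upd \<omega> (x, y) M) u w a c = block \<omega> u w a c"
  using assms by (auto simp: block_def)

lemma walk_block_upd_other:
  assumes "x < y" "{x, y} \<notin> set (traversals u vs)"
  shows "walk_block k (fun_upd \<omega> (x, y) M) u vs a b = walk_block k \<omega> u vs a b"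
  using assms(2)
proof (induction vs arbitrary: u a)
  case (Cons w vs)
  then have other: "{u, w} \<noteq> {x, y}" "{x, y} \<notin> set (traversals w vs)" by auto
  show ?case
    unfolding walk_block.simps block_upd_other[OF assms(1) other(1)] Cons.IH[OF other(2)] ..
qed simp

lemma sum_single_row:
  fixes g :: "nat \<Rightarrow> 'a :: semiring_0"
  assumes "a < k"
  shows "(\<Sum>c<k. \<Sum>d<k. (if c = a then g d else 0) * h c d) = (\<Sum>d<k. g d * h a d)"
proof -
  have "(\<Sum>c<k. \<Sum>d<k. (if c = a then g d else 0) * h c d) =
      (\<Sum>c<k. if c = a then \<Sum>d<k. g d * h a d else 0)"
    by (intro sum.cong) auto
  then show ?thesis using assms by simp
qed

text \<open>The sample enters exactly one factor of the product. The coefficients may depend on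
  \<omega> but not on \<open>M\<close>, so \<open>M\<close> can be integrated with the other samples
  fixed.\<close>

lemma walk_block_linear:
  assumes "x < y" "count_list (traversals u vs) {x, y} = 1" "a < k"
  shows "\<exists>f. \<forall>M. walk_block k (fun_upd \<omega> (x, y) M) u vs a b = (\<Sum>c<k. \<Sum>d<k. f c d * M $$ (c, d))"
  using assms(2,3)
proof (induction vs arbitrary: u a)
  case (Cons w vs)
  show ?case
  proof (cases "{u, w} = {x, y}")
    case True
    then have "{x, y} \<notin> set (traversals w vs)"
      using Cons.prems by (simp add: count_list_0_iff)
    then have r: "walk_block k (fun_upd \<omega> (x, y) M) w vs c b = walk_block k \<omega> w vs c b" for M c
      by (rule walk_block_upd_other[OF assms(1)])
    consider "u = x" "w = y" | "u = y" "w = x" using True by (auto simp: doubleton_eq_iff)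
    then show ?thesis
    proof cases
      case 1
      have eq: "walk_block k (fun_upd \<omega> (x, y) M) u (w # vs) a b =
          (\<Sum>c<k. \<Sum>d<k. (if c = a then walk_block k \<omega> w vs d b else 0) * M $$ (c, d))" for M
        unfolding sum_single_row[OF Cons.prems(2)] walk_block.simps r
        using 1 assms(1) by (simp add: block_def mult.commute)
      show ?thesis by (intro exI allI) (rule eq)
    next
      \<comment> \<open>The edge is traversed backwards, so the transpose of \<open>M\<close> enters
        and the coefficients sit in column \<open>a\<close> instead of row \<open>a\<close>.\<close>
      case 2
      have eq: "walk_block k (fun_upd \<omega> (x, y) M) u (w # vs) a b =
          (\<Sum>c<k. \<Sum>d<k. (if d = a then walk_block k \<omega> w vs c b else 0) * M $$ (c, d))" for M
        unfolding walk_block.simps r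
        by (subst sum.swap, subst sum_single_row[OF Cons.prems(2)])
          (use 2 assms(1) in \<open>simp add: block_def mult.commute\<close>)
      show ?thesis by (intro exI allI) (rule eq)
    qed
  next
    case False
    then have "count_list (traversals w vs) {x, y} = 1" using Cons.prems by simp
    then have "\<forall>e. \<exists>f. e < k \<longrightarrow> (\<forall>M. walk_block k (fun_upd \<omega> (x, y) M) w vs e b =
        (\<Sum>c<k. \<Sum>d<k. f c d * M $$ (c, d)))"
      using Cons.IH by blast
    then obtain F where F: "\<And>e M. e < k \<Longrightarrow> walk_block k (fun_upd \<omega> (x, y) M) w vs e b =
        (\<Sum>c<k. \<Sum>d<k. F e c d * M $$ (c, d))"
      by metis
    have eq: "walk_block k (fun_upd \<omega> (x, y) M) u (w # vs) a b =
        (\<Sum>c<k. \<Sum>d<k. (\<Sum>e<k. block \<omega> u w a e * F e c d) * M $$ (c, d))" for M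
    proof -
      have eq: "walk_block k (fun_upd \<omega> (x, y) M) u (w # vs) a b =
          (\<Sum>e<k. \<Sum>c<k. \<Sum>d<k. block \<omega> u w a e * F e c d * M $$ (c, d))"
        by (simp add: F block_upd_other[OF assms(1) False] sum_distrib_left mult.assoc)
      also have "\<dots> = (\<Sum>c<k. \<Sum>e<k. \<Sum>d<k. block \<omega> u w a e * F e c d * M $$ (c, d))"
        by (rule sum.swap)
      also have "\<dots> = (\<Sum>c<k. \<Sum>d<k. \<Sum>e<k. block \<omega> u w a e * F e c d * M $$ (c, d))"
        by (intro sum.cong refl sum.swap)
      finally show ?thesis by (simp add: sum_distrib_right)
    qed
    show ?thesis by (intro exI allI) (rule eq)
  qed
qed simp

text \<open>A loop has a zero block and no sample. This settles the case of
  \<open>integral_walk_block_eq_0\<close> where the edge traversed once is a loop.\<close>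

lemma walk_block_loop:
  assumes "{x} \<in> set (traversals u vs)"
  shows "walk_block k \<omega> u vs a b = 0"
  using assms
proof (induction vs arbitrary: u a)
  case (Cons w vs)
  then show ?case by (auto simp: block_def)
qed simp

lemma traversals_subset:
  assumes "e \<in> set (traversals u vs)" "u < n" "set vs \<subseteq> {..<n}"
  shows "\<exists>x<n. \<exists>y<n. e = {x, y}"
  using assms
  by (induction vs arbitrary: u) auto

text \<open>A column of the product is a unit vector under successive contractions.\<close>

lemma sum_walk_block_le_1:
  assumes contr: "\<And>i j y. i < n \<Longrightarrow> j < n \<Longrightarrow>
      (\<Sum>a<k. (\<Sum>c<k. block \<omega> i j a c * y c)\<^sup>2) \<le> (\<Sum>c<k. (y c)\<^sup>2)"
    and "u < n" "set vs \<subseteq> {..<n}" "b < k"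
  shows "(\<Sum>a<k. (walk_block k \<omega> u vs a b)\<^sup>2) \<le> 1"
  using assms(2,3)
proof (induction vs arbitrary: u)
  case Nil
  have "(\<Sum>a<k. (walk_block k \<omega> u [] a b)\<^sup>2) = (\<Sum>a<k. if a = b then 1 else 0)"
    by (intro sum.cong) auto
  then show ?case by simp
next
  case (Cons w vs)
  then have "(\<Sum>a<k. (walk_block k \<omega> u (w # vs) a b)\<^sup>2) \<le> (\<Sum>c<k. (walk_block k \<omega> w vs c b)\<^sup>2)"
    using contr[of u w "\<lambda>c. walk_block k \<omega> w vs c b"] by simp
  then show ?case using Cons.IH[of w] Cons.prems by simp
qed

lemma block_contraction:
  assumes car: "\<And>i j. (i, j) \<in> upper_pairs n \<Longrightarrow> \<omega> (i, j) \<in> carrier_mat k k"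
    and le: "\<And>e. e \<in> upper_pairs n \<Longrightarrow> spectral_norm (\<omega> e) \<le> 1"
    and "i < n" "j < n"
  shows "(\<Sum>a<k. (\<Sum>c<k. block \<omega> i j a c * y c)\<^sup>2) \<le> (\<Sum>c<k. (y c)\<^sup>2)"
proof -
  consider "i < j" | "j < i" | "i = j" by linarith
  then show ?thesis
  proof cases
    case 1
    then have "(i, j) \<in> upper_pairs n" using assms by (simp add: upper_pairs_def)
    from spectral_norm_le_1_contraction[OF car[OF this] le[OF this]] show ?thesis
      using 1 by (simp add: block_def)
  next
    case 2
    then have "(j, i) \<in> upper_pairs n" using assms by (simp add: upper_pairs_def)
    from contraction_transpose[OF spectral_norm_le_1_contraction[OF car[OF this] le[OF this]]] show ?thesis
      using 2 by (simp add: block_def)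
  next
    case 3
    then show ?thesis by (simp add: block_def sum_nonneg)
  qed
qed

section \<open>Integration over the samples\<close>

locale lift_sample = prob_space \<pi> for \<pi> :: "real Matrix.mat measure" +
  fixes n k :: nat
  assumes sets_\<pi>: "sets \<pi> = sets (mat_borel k)"
    and centered_\<pi>: "centered k \<pi>"
    and norm_le_1: "AE M in \<pi>. spectral_norm M \<le> 1"
begin

abbreviation "\<Omega> \<equiv> sample_space n \<pi>"

lemma prob_space_\<Omega>: "prob_space \<Omega>"
  unfolding sample_space_def by (rule prob_space_PiM) (rule prob_space_axioms)

lemma sample_carrier:
  assumes "\<omega> \<in> space \<Omega>" "(i, j) \<in> upper_pairs n"
  shows "\<omega> (i, j) \<in> carrier_mat k k"
  using assms space_mat_borel[OF sets_\<pi>] by (auto simp: sample_space_def space_PiM)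

lemma measurable_block:
  assumes "i < n" "j < n" "a < k" "c < k"
  shows "(\<lambda>\<omega>. block \<omega> i j a c) \<in> borel_measurable \<Omega>"
proof -
  have pr: "(\<lambda>\<omega>. \<omega> e $$ (a, c)) \<in> borel_measurable \<Omega>" if "e \<in> upper_pairs n" "a < k" "c < k" for e a c
    unfolding sample_space_def
    using measurable_compose[OF measurable_component_singleton[OF that(1), of "\<lambda>_. \<pi>"]
        measurable_mat_entry[OF sets_\<pi> that(2,3)]] .
  consider "i < j" | "j < i" | "i = j" by linarith
  then show ?thesis
    by cases (use assms in \<open>auto simp: block_def upper_pairs_def intro!: pr\<close>)
qed

lemma measurable_walk_block:
  assumes "u < n" "set vs \<subseteq> {..<n}" "a < k"
  shows "(\<lambda>\<omega>. walk_block k \<omega> u vs a b) \<in> borel_measurable \<Omega>"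
  using assms
proof (induction vs arbitrary: u a)
  case (Cons w vs)
  then show ?case
    by (auto intro!: borel_measurable_sum borel_measurable_times measurable_block)
qed simp

lemma AE_walk_block_le:
  assumes "u < n" "set vs \<subseteq> {..<n}" "a < k" "b < k"
  shows "AE \<omega> in \<Omega>. \<bar>walk_block k \<omega> u vs a b\<bar> \<le> 1"
proof -
  have "AE \<omega> in \<Omega>. spectral_norm (\<omega> e) \<le> 1" if "e \<in> upper_pairs n" for e
    unfolding sample_space_def
    by (rule AE_PiM_component[OF prob_space_axioms that norm_le_1])
  then have "AE \<omega> in \<Omega>. \<forall>e\<in>upper_pairs n. spectral_norm (\<omega> e) \<le> 1"
    by (intro AE_finite_allI finite_upper_pairs)
  then show ?thesis
  proof (rule AE_mp, intro AE_I2 impI)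
    fix \<omega> assume sp: "\<omega> \<in> space \<Omega>" and le: "\<forall>e\<in>upper_pairs n. spectral_norm (\<omega> e) \<le> 1"
    have "(walk_block k \<omega> u vs a b)\<^sup>2 \<le> (\<Sum>a<k. (walk_block k \<omega> u vs a b)\<^sup>2)"
      by (rule member_le_sum) (use assms in auto)
    also have "\<dots> \<le> 1"
      using sample_carrier[OF sp] le assms
      by (intro sum_walk_block_le_1[where n = n] block_contraction[where n = n]) auto
    finally show "\<bar>walk_block k \<omega> u vs a b\<bar> \<le> 1" by (simp add: abs_square_le_1)
  qed
qed

lemma integrable_walk_block:
  assumes "u < n" "set vs \<subseteq> {..<n}" "a < k" "b < k"
  shows "integrable \<Omega> (\<lambda>\<omega>. walk_block k \<omega> u vs a b)"
proof -
  interpret S: prob_space \<Omega> by (rule prob_space_\<Omega>)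
  show ?thesis
    using AE_walk_block_le[OF assms] by (intro S.integrable_const_bound[of _ 1] measurable_walk_block assms) auto
qed

lemma abs_integral_walk_block_le:
  assumes "u < n" "set vs \<subseteq> {..<n}" "a < k" "b < k"
  shows "\<bar>\<integral>\<omega>. walk_block k \<omega> u vs a b \<partial>\<Omega>\<bar> \<le> 1"
proof -
  interpret S: prob_space \<Omega> by (rule prob_space_\<Omega>)
  have "\<bar>\<integral>\<omega>. walk_block k \<omega> u vs a b \<partial>\<Omega>\<bar> \<le> (\<integral>\<omega>. \<bar>walk_block k \<omega> u vs a b\<bar> \<partial>\<Omega>)"
    by (rule integral_abs_bound)
  also have "\<dots> \<le> (\<integral>\<omega>. 1 \<partial>\<Omega>)"
    by (intro integral_mono_AE AE_walk_block_le integrable_abs integrable_walk_block assms) simp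
  finally show ?thesis by (simp add: S.prob_space)
qed

text \<open>Some edge is traversed exactly once. Unless it is a loop, Fubini allows its sample to be
  integrated first, and a linear function of a centered matrix has mean zero.\<close>

lemma integral_walk_block_eq_0:
  assumes vs: "u < n" "set vs \<subseteq> {..<n}" "a < k" "b < k"
    and "\<not> completes {} (traversals u vs)"
  shows "(\<integral>\<omega>. walk_block k \<omega> u vs a b \<partial>\<Omega>) = 0"
proof -
  obtain e where e: "count_list (traversals u vs) e = 1"
    using assms(5) by (auto simp: completes_def)
  then have "e \<in> set (traversals u vs)" by (metis count_notin zero_neq_one)
  then obtain x y where xy: "e = {x, y}" "x < n" "y < n" "x \<le> y"
    using traversals_subset[OF _ vs(1,2)] by (metis insert_commute nle_le)
  show ?thesis
  proof (cases "x = y")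
    case True
    then show ?thesis
      using walk_block_loop[of x u vs] \<open>e \<in> set (traversals u vs)\<close> xy by simp
  next
    case False
    then have "x < y" using xy by simp
    interpret P: product_sigma_finite "\<lambda>_ :: nat \<times> nat. \<pi>"
      by (rule product_sigma_finite.intro) (rule sigma_finite_measure_axioms)
    let ?I = "upper_pairs n - {(x, y)}"
    have I: "upper_pairs n = insert (x, y) ?I"
      using xy \<open>x < y\<close> by (auto simp: upper_pairs_def)
    have zero: "(\<integral>M. walk_block k (fun_upd \<omega> (x, y) M) u vs a b \<partial>\<pi>) = 0" for \<omega>
    proof -
      obtain f where "\<And>M. walk_block k (fun_upd \<omega> (x, y) M) u vs a b = (\<Sum>c<k. \<Sum>d<k. f c d * M $$ (c, d))"
        using walk_block_linear[OF \<open>x < y\<close> _ vs(3), of u vs] e xy by blast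
      then have "(\<integral>M. walk_block k (fun_upd \<omega> (x, y) M) u vs a b \<partial>\<pi>) =
          (\<integral>M. (\<Sum>c<k. \<Sum>d<k. f c d * M $$ (c, d)) \<partial>\<pi>)" by simp
      also have "\<dots> = (\<Sum>c<k. \<integral>M. (\<Sum>d<k. f c d * M $$ (c, d)) \<partial>\<pi>)"
        using centered_\<pi> by (intro Bochner_Integration.integral_sum Bochner_Integration.integrable_sum
            integrable_mult_right) (auto simp: centered_def)
      also have "\<dots> = (\<Sum>c<k. \<Sum>d<k. \<integral>M. f c d * M $$ (c, d) \<partial>\<pi>)"
        using centered_\<pi> by (intro sum.cong refl Bochner_Integration.integral_sum
            integrable_mult_right) (auto simp: centered_def)
      also have "\<dots> = 0"
        using centered_\<pi> by (simp add: centered_def)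
      finally show ?thesis .
    qed
    have "integrable (PiM (insert (x, y) ?I) (\<lambda>_. \<pi>)) (\<lambda>\<omega>. walk_block k \<omega> u vs a b)"
      using integrable_walk_block[OF vs] unfolding sample_space_def I[symmetric] .
    from P.product_integral_insert[OF _ _ this] finite_upper_pairs[of n] zero
    show ?thesis unfolding sample_space_def by (subst I) simp
  qed
qed

lemma expected_trace_le:
  assumes w: "bounded_weights n p (\<lambda>i j. \<bar>A $$ (i, j)\<bar>) m \<sigma>"
  defines "T \<equiv> \<lambda>\<omega>. \<Sum>r<n * k. (matrix_lift n k A \<omega> ^\<^sub>m (2 * p)) $$ (r, r)"
  shows "integrable \<Omega> T" "(\<integral>\<omega>. T \<omega> \<partial>\<Omega>) \<le> n * k * bounded_weights.growth p m \<sigma> ^ (2 * p)"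
proof -
  interpret W: bounded_weights n p "\<lambda>i j. \<bar>A $$ (i, j)\<bar>" m \<sigma> by (rule w)
  let ?A = "\<lambda>i j. A $$ (i, j)"
  let ?V = "walks n (2 * p)"
  let ?T = "\<lambda>\<omega>. \<Sum>u<n. \<Sum>a<k. \<Sum>vs\<in>?V. of_bool (last (u # vs) = u) * (walk_weight ?A u vs * walk_block k \<omega> u vs a a)"
  have T: "T \<omega> = ?T \<omega>" if "\<omega> \<in> space \<Omega>" for \<omega>
    unfolding T_def sum_lessThan_mult
    using sample_carrier[OF that] by (intro sum.cong refl matrix_lift_power_index) auto
  have int: "integrable \<Omega> (\<lambda>\<omega>. of_bool (last (u # vs) = u) * (walk_weight ?A u vs * walk_block k \<omega> u vs a a))"
    if "u < n" "a < k" "vs \<in> ?V" for u a vs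
    using that by (intro integrable_mult_right integrable_walk_block) (auto simp: walks_def)
  have intT: "integrable \<Omega> ?T"
    by (intro Bochner_Integration.integrable_sum int) auto
  then show "integrable \<Omega> T"
    by (rule Bochner_Integration.integrable_cong[THEN iffD2, OF refl, rotated]) (simp only: T)
  have abs_ww: "\<bar>walk_weight ?A u vs\<bar> = walk_weight (\<lambda>i j. \<bar>A $$ (i, j)\<bar>) u vs" for u vs
    by (induction vs arbitrary: u) (auto simp: abs_mult)
  have "(\<integral>\<omega>. T \<omega> \<partial>\<Omega>) = (\<integral>\<omega>. ?T \<omega> \<partial>\<Omega>)"
    by (rule Bochner_Integration.integral_cong[OF refl T])
  also have "\<dots> = (\<Sum>u<n. \<integral>\<omega>. (\<Sum>a<k. \<Sum>vs\<in>?V. of_bool (last (u # vs) = u) * (walk_weight ?A u vs * walk_block k \<omega> u vs a a)) \<partial>\<Omega>)"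
    by (intro Bochner_Integration.integral_sum Bochner_Integration.integrable_sum int) auto
  also have "\<dots> = (\<Sum>u<n. \<Sum>a<k. \<integral>\<omega>. (\<Sum>vs\<in>?V. of_bool (last (u # vs) = u) * (walk_weight ?A u vs * walk_block k \<omega> u vs a a)) \<partial>\<Omega>)"
    by (intro sum.cong refl Bochner_Integration.integral_sum Bochner_Integration.integrable_sum int) auto
  also have "\<dots> = (\<Sum>u<n. \<Sum>a<k. \<Sum>vs\<in>?V. \<integral>\<omega>. of_bool (last (u # vs) = u) * (walk_weight ?A u vs * walk_block k \<omega> u vs a a) \<partial>\<Omega>)"
    by (intro sum.cong refl Bochner_Integration.integral_sum int) auto
  also have "\<dots> \<le> (\<Sum>u<n. \<Sum>a<k. \<Sum>vs\<in>?V. of_bool (completes {} (traversals u vs)) * walk_weight (\<lambda>i j. \<bar>A $$ (i, j)\<bar>) u vs)"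
  proof (intro sum_mono)
    fix u a vs assume "u \<in> {..<n}" "a \<in> {..<k}" "vs \<in> ?V"
    then have vs: "u < n" "set vs \<subseteq> {..<n}" "a < k" "a < k" by (auto simp: walks_def)
    let ?I = "\<integral>\<omega>. walk_block k \<omega> u vs a a \<partial>\<Omega>"
    have "(\<integral>\<omega>. of_bool (last (u # vs) = u) * (walk_weight ?A u vs * walk_block k \<omega> u vs a a) \<partial>\<Omega>) =
        of_bool (last (u # vs) = u) * (walk_weight ?A u vs * ?I)" by simp
    also have "\<dots> \<le> \<bar>of_bool (last (u # vs) = u) * (walk_weight ?A u vs * ?I)\<bar>" by (rule abs_ge_self)
    \<comment> \<open>The condition that the walk returns to \<open>u\<close> is given up
      here.\<close>
    also have "\<dots> \<le> \<bar>walk_weight ?A u vs\<bar> * \<bar>?I\<bar>" by (simp add: abs_mult)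
    also have "\<dots> \<le> of_bool (completes {} (traversals u vs)) * \<bar>walk_weight ?A u vs\<bar>"
      using integral_walk_block_eq_0[OF vs] abs_integral_walk_block_le[OF vs]
      by (cases "completes {} (traversals u vs)") (auto intro: mult_left_le)
    finally show "(\<integral>\<omega>. of_bool (last (u # vs) = u) * (walk_weight ?A u vs * walk_block k \<omega> u vs a a) \<partial>\<Omega>) \<le>
        of_bool (completes {} (traversals u vs)) * walk_weight (\<lambda>i j. \<bar>A $$ (i, j)\<bar>) u vs"
      by (simp only: abs_ww)
  qed
  also have "\<dots> \<le> (\<Sum>u<n. \<Sum>a<k. W.growth ^ (2 * p))"
    by (intro sum_mono W.sum_closed_walks_le) auto
  also have "\<dots> = n * k * W.growth ^ (2 * p)" by simp
  finally show "(\<integral>\<omega>. T \<omega> \<partial>\<Omega>) \<le> n * k * W.growth ^ (2 * p)" .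
qed

text \<open>The tangent to x^(2p) at \<open>B\<close> bounds the norm by an affine function of the
  trace, and the hypothesis on \<open>B\<close> makes the mean of the correction nonpositive. A free
  \<open>B\<close>, instead of a root of the moment bound, also serves when the growth factor is
  0.\<close>

lemma expected_norm_le:
  assumes A: "A \<in> carrier_mat n n" "transpose_mat A = A"
    and w: "bounded_weights n p (\<lambda>i j. \<bar>A $$ (i, j)\<bar>) m \<sigma>"
    and B: "0 < B" "n * k * bounded_weights.growth p m \<sigma> ^ (2 * p) \<le> B ^ (2 * p)"
  shows "(\<integral>\<omega>. spectral_norm (matrix_lift n k A \<omega>) \<partial>\<Omega>) \<le> B"
proof -
  interpret S: prob_space \<Omega> by (rule prob_space_\<Omega>)
  interpret W: bounded_weights n p "\<lambda>i j. \<bar>A $$ (i, j)\<bar>" m \<sigma> by (rule w)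
  define T where "T \<omega> = (\<Sum>r<n * k. (matrix_lift n k A \<omega> ^\<^sub>m (2 * p)) $$ (r, r))" for \<omega>
  note T = expected_trace_le[OF w, folded T_def]
  let ?X = "\<lambda>\<omega>. spectral_norm (matrix_lift n k A \<omega>)"
  define N where "N = 2 * p"
  have N: "0 < N" using W.p_pos by (simp add: N_def)
  have le: "?X \<omega> \<le> B + B / N * (T \<omega> / B ^ N - 1)" if "\<omega> \<in> space \<Omega>" for \<omega>
  proof -
    have L: "matrix_lift n k A \<omega> \<in> carrier_mat (n * k) (n * k)"
      "transpose_mat (matrix_lift n k A \<omega>) = matrix_lift n k A \<omega>"
      using sample_carrier[OF that] A by (auto intro!: matrix_lift_carrier transpose_matrix_lift)
    \<comment> \<open>Bernoulli's inequality plays the role of Jensen's.\<close>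
    have "1 + N * (?X \<omega> / B - 1) \<le> (1 + (?X \<omega> / B - 1)) ^ N"
      using B spectral_norm_nonneg[OF L(1)] by (intro Bernoulli_inequality) simp
    also have "\<dots> = ?X \<omega> ^ N / B ^ N" by (simp add: power_divide)
    also have "\<dots> \<le> T \<omega> / B ^ N"
      unfolding T_def N_def using B W.p_pos
      by (intro divide_right_mono spectral_norm_power_le_trace[OF L]) auto
    finally show ?thesis using B N by (simp add: field_simps)
  qed
  have "(\<integral>\<omega>. ?X \<omega> \<partial>\<Omega>) \<le> (\<integral>\<omega>. B + B / N * (T \<omega> / B ^ N - 1) \<partial>\<Omega>)"
    using T(1) by (intro integral_mono le integrable_lift_norm prob_space_axioms sets_\<pi> norm_le_1) auto
  also have "\<dots> = B + B / N * ((\<integral>\<omega>. T \<omega> \<partial>\<Omega>) / B ^ N - 1)"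
    using T(1) by (simp add: S.prob_space)
  also have "\<dots> \<le> B + B / N * (B ^ N / B ^ N - 1)"
    using T(2) B N by (intro add_left_mono mult_left_mono diff_right_mono divide_right_mono) (auto simp: N_def)
  finally show ?thesis using B by simp
qed

end

section \<open>The choice of p and of the constant\<close>

theorem theorem1p3:
  shows "\<exists>C :: real. C > 0 \<and>
    (\<forall>(n :: nat) (k :: nat) (A :: real Matrix.mat) (\<pi> :: real Matrix.mat measure) (\<epsilon> :: real).
       n \<ge> 2 \<longrightarrow> k \<ge> 1 \<longrightarrow>
       A \<in> carrier_mat n n \<longrightarrow> transpose_mat A = A \<longrightarrow> (\<forall>i<n. A $$ (i, i) = 0) \<longrightarrow>
       prob_space \<pi> \<longrightarrow> sets \<pi> = sets (mat_borel k) \<longrightarrow>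
       centered k \<pi> \<longrightarrow> (AE M in \<pi>. spectral_norm M \<le> 1) \<longrightarrow>
       0 < \<epsilon> \<longrightarrow> \<epsilon> \<le> 1 / 2 \<longrightarrow>
       (\<integral>\<omega>. spectral_norm (matrix_lift n k A \<omega>) \<partial>sample_space n \<pi>)
         \<le> 2 * (1 + \<epsilon>) * row_sigma n A
           + C / sqrt (ln (1 + \<epsilon>)) * max_entry n A * sqrt (ln (real (k * n))))"
proof (intro exI[of _ "63 / 2 :: real"] conjI allI impI)
  fix n k :: nat and A :: "real Matrix.mat" and \<pi> :: "real Matrix.mat measure" and \<epsilon> :: real
  assume nk: "2 \<le> n" "1 \<le> k"
    and A: "A \<in> carrier_mat n n" "transpose_mat A = A" "\<forall>i<n. A $$ (i, i) = 0"
    and \<pi>: "prob_space \<pi>" "sets \<pi> = sets (mat_borel k)" "centered k \<pi>" "AE M in \<pi>. spectral_norm M \<le> 1"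
    and \<epsilon>: "0 < \<epsilon>" "\<epsilon> \<le> 1 / 2"
  interpret prob_space \<pi> by (rule \<pi>)
  interpret lift_sample \<pi> n k by unfold_locales (rule \<pi>)+
  define m where "m = max_entry n A"
  define \<sigma> where "\<sigma> = row_sigma n A"
  \<comment> \<open>The solution of (1 + \<epsilon>)^q = k n; taking 2 p \<ge> q lets (1 +
    \<epsilon>)^(2p) absorb the dimension factor.\<close>
  define q where "q = ln (real (k * n)) / ln (1 + \<epsilon>)"
  define p where "p = nat \<lceil>q / 2\<rceil>"
  have kn: "2 \<le> real (k * n)"
    using mult_le_mono[OF nk(2,1)] by (metis mult_1 of_nat_le_iff of_nat_numeral)
  have l: "0 < ln (1 + \<epsilon>)" using \<epsilon> by simp
  \<comment> \<open>Because 1 + \<epsilon> \<le> 2 \<le> k n. It controls the rounding: p \<le> q /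
    2 + 1 \<le> 3 q / 2.\<close>
  have "1 \<le> q"
    using kn \<epsilon> l by (simp add: q_def)
  then have p: "0 < p" "q \<le> 2 * p" "p \<le> 3 / 2 * q"
    unfolding p_def by linarith+
  have row_le: "sqrt (\<Sum>j<n. (A $$ (i, j))\<^sup>2) \<le> \<sigma>" if "i < n" for i
    unfolding \<sigma>_def row_sigma_def using that by (intro Max_ge) auto
  then have "sqrt (\<Sum>j<n. (A $$ (0, j))\<^sup>2) \<le> \<sigma>" using nk by simp
  moreover have "0 \<le> sqrt (\<Sum>j<n. (A $$ (0, j))\<^sup>2)" by (simp add: sum_nonneg)
  ultimately have \<sigma>0: "0 \<le> \<sigma>" by linarith
  interpret W: bounded_weights n p "\<lambda>i j. \<bar>A $$ (i, j)\<bar>" m \<sigma>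
  proof
    fix i j assume ij: "i < n" "j < n"
    show "\<bar>A $$ (i, j)\<bar> = \<bar>A $$ (j, i)\<bar>"
      using index_transpose_mat(1)[of i A j] A ij by simp
    show "\<bar>A $$ (i, j)\<bar> \<le> m"
      unfolding m_def max_entry_def using ij by (intro Max_ge) auto
  next
    fix i assume "i < n"
    from row_le[OF this] show "(\<Sum>j<n. \<bar>A $$ (i, j)\<bar>\<^sup>2) \<le> \<sigma>\<^sup>2"
      by (simp add: sqrt_le_D)
  qed (use p A in auto)
  have m0: "0 \<le> m" using W.max_nonneg[of 0] nk by simp
  have S_bound: "W.S \<le> \<sigma> + m * sqrt p"
  proof -
    have "W.S \<le> sqrt (\<sigma>\<^sup>2) + sqrt (p * m\<^sup>2)"
      unfolding W.S_def by (rule sqrt_add_le_add_sqrt) auto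
    then show ?thesis using \<sigma>0 m0 by (simp add: real_sqrt_mult mult.commute)
  qed
  have g0: "0 \<le> W.growth" using W.S_nonneg m0 by (simp add: W.growth_def)
  have "(1 + \<epsilon>) ^ (2 * p) = exp (2 * p * ln (1 + \<epsilon>))"
    using \<epsilon> exp_of_nat_mult[of "2 * p" "ln (1 + \<epsilon>)"] by simp
  also have "\<dots> \<ge> exp (q * ln (1 + \<epsilon>))"
    using p l by (simp add: mult_right_mono)
  also have "exp (q * ln (1 + \<epsilon>)) = k * n"
    using l kn by (simp add: q_def)
  finally have pow: "real (k * n) \<le> (1 + \<epsilon>) ^ (2 * p)" .
  have "(\<integral>\<omega>. spectral_norm (matrix_lift n k A \<omega>) \<partial>\<Omega>) \<le> (1 + \<epsilon>) * W.growth"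
  proof (rule field_le_epsilon) \<comment> \<open>\<open>W.growth = 0\<close> when \<open>A = 0\<close>\<close>
    fix \<delta> :: real assume "0 < \<delta>"
    have "n * k * W.growth ^ (2 * p) \<le> (1 + \<epsilon>) ^ (2 * p) * W.growth ^ (2 * p)"
      using pow by (intro mult_right_mono) (auto simp: g0 mult.commute)
    also have "\<dots> \<le> ((1 + \<epsilon>) * W.growth + \<delta>) ^ (2 * p)"
      unfolding power_mult_distrib[symmetric] using \<epsilon> g0 \<open>0 < \<delta>\<close> by (intro power_mono) auto
    finally show "(\<integral>\<omega>. spectral_norm (matrix_lift n k A \<omega>) \<partial>\<Omega>) \<le> (1 + \<epsilon>) * W.growth + \<delta>"
      using \<epsilon> g0 \<open>0 < \<delta>\<close> by (intro expected_norm_le[OF A(1,2) W.bounded_weights_axioms] add_nonneg_pos) auto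
  qed
  also have "\<dots> \<le> (1 + \<epsilon>) * (2 * \<sigma> + 14 * (m * sqrt p))"
    using S_bound \<epsilon> by (intro mult_left_mono) (auto simp: W.growth_def)
  also have "\<dots> = 2 * (1 + \<epsilon>) * \<sigma> + 14 * ((1 + \<epsilon>) * (m * sqrt p))"
    by (simp add: algebra_simps)
  \<comment> \<open>The 14 is 12 from \<open>W.growth\<close> plus 2 from twice the bound on
    \<open>W.S\<close>. One factor 3 / 2 bounds 1 + \<epsilon>; the other comes from p \<le> 3 q / 2
    \<le> 9 q / 4. Their product is 63 / 2.\<close>
  also have "\<dots> \<le> 2 * (1 + \<epsilon>) * \<sigma> + 14 * (3 / 2 * (m * (3 / 2 * sqrt q)))"
  proof -
    have "sqrt p \<le> sqrt ((3 / 2)\<^sup>2 * q)"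
      using p \<open>1 \<le> q\<close> by (intro real_sqrt_le_mono) (simp add: power2_eq_square)
    also have "\<dots> = 3 / 2 * sqrt q" by (simp add: real_sqrt_mult)
    finally have "sqrt p \<le> 3 / 2 * sqrt q" .
    then show ?thesis
      using \<epsilon> m0 by (intro add_left_mono mult_left_mono mult_mono) auto
  qed
  also have "\<dots> = 2 * (1 + \<epsilon>) * \<sigma> + 63 / 2 / sqrt (ln (1 + \<epsilon>)) * m * sqrt (ln (real (k * n)))"
    by (simp add: q_def real_sqrt_divide)
  finally show "(\<integral>\<omega>. spectral_norm (matrix_lift n k A \<omega>) \<partial>\<Omega>) \<le> 2 * (1 + \<epsilon>) * row_sigma n A
      + 63 / 2 / sqrt (ln (1 + \<epsilon>)) * max_entry n A * sqrt (ln (real (k * n)))"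
    by (simp only: \<sigma>_def m_def)
qed simp

end
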